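(* Let $(\mathfrak{H},[\cdot,\cdot])$ be a Krein space with fundamental symmetry $J$, let $\mathcal{F}=\{f_n\}_{n\in\mathbb{N}}\subset\mathfrak{H}$ be a $J$-frame with associated subspaces $\mathcal{M}_\pm$, suppose that $\mathcal{D}:=\mathcal{M}_+\dot{+}\mathcal{M}_-\ne\mathfrak{H}$, and suppose that $\mathcal{M}_+$ and $\mathcal{M}_-$ are $J$-orthogonal. Let $S$ be the (boundedly invertible) operator in $\widehat{\mathfrak{H}}$ given by $Sf=\sum_{n=1}^\infty[f,f_n]f_n$, where for $f\in\widehat{\mathfrak{H}}$ the symbol $[f,f_n]$ is understood as $[f,f_n]_1$. Then for all $f$ in the energetic linear manifold $\mathfrak{D}$, $$f=\sum_{n=1}^\infty[f,f_n]S^{-1}f_n,$$ where the series converge in the Hilbert space $(\widehat{\mathfrak{H}},(\cdot,\cdot)_1)$.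
   Context: A Krein space $(\mathfrak{H},[\cdot,\cdot])$ is a complex (infinite-dimensional) linear space with an indefinite inner product admitting a fundamental decomposition $\mathfrak{H}=\mathfrak{H}_+[\dot{+}]\mathfrak{H}_-$, a $[\cdot,\cdot]$-orthogonal direct sum of Hilbert spaces $(\mathfrak{H}_+,[\cdot,\cdot])$ and $(\mathfrak{H}_-,-[\cdot,\cdot])$. A fundamental decomposition is fixed; its fundamental symmetry is $J(f_++f_-)=f_+-f_-$ ($f_\pm\in\mathfrak{H}_\pm$), and $(\cdot,\cdot)=[J\cdot,\cdot]$, $\|\cdot\|=\sqrt{(\cdot,\cdot)}$ is the associated Hilbert space inner product and norm. Subspaces are closed and topological notions refer to $\|\cdot\|$ unless stated otherwise. A subspace $\mathcal{L}$ is positive (negative) if $[f,f]>0$ ($[f,f]<0$) for all nonzero $f\in\mathcal{L}$, and maximal positive (negative) if it is not a proper subspace of another positive (negative) subspace. $\mathcal{L}_1,\mathcal{L}_2$ are $J$-orthogonal if $[f,g]=0$ for all $f\in\mathcal{L}_1$, $g\in\mathcal{L}_2$. For $\mathcal{F}=\{f_n\}$ put $\mathbb{N}_+=\{n:[f_n,f_n]\ge0\}$, $\mathbb{N}_-=\{n:[f_n,f_n]<0\}$, $\mathcal{F}_\pm=\{f_n\}_{n\in\mathbb{N}_\pm}$, $\mathcal{M}_\pm=\overline{\mathrm{span}\,\mathcal{F}_\pm}$. $\mathcal{F}$ is a $J$-frame if $\mathcal{M}_+$ is maximal positive, $\mathcal{M}_-$ is maximal negative, and there are constants $0<A\le B$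 with $A|[f,f]|\le\sum_{n\in\mathbb{N}_+}|[f,f_n]|^2\le B|[f,f]|$ for all $f\in\mathrm{span}\,\mathcal{F}_+$, and $A|[f,f]|\le\sum_{n\in\mathbb{N}_-}|[f,f_n]|^2\le B|[f,f]|$ for all $f\in\mathrm{span}\,\mathcal{F}_-$. For $f=f_{\mathcal{M}_+}+f_{\mathcal{M}_-}$, $g=g_{\mathcal{M}_+}+g_{\mathcal{M}_-}$ in $\mathcal{D}$ (components in $\mathcal{M}_\pm$), $(f,g)_1:=[f_{\mathcal{M}_+},g_{\mathcal{M}_+}]-[f_{\mathcal{M}_-},g_{\mathcal{M}_-}]$, $\|f\|_1^2=(f,f)_1$. $(\widehat{\mathfrak{H}},(\cdot,\cdot)_1)$ is the completion of $\mathcal{D}$ with respect to $(\cdot,\cdot)_1$; it is the $(\cdot,\cdot)_1$-orthogonal sum of the completions $\widehat{\mathcal{M}}_\pm$ of $(\mathcal{M}_\pm,\pm[\cdot,\cdot])$. The form $[\cdot,\cdot]$ on $\mathcal{M}_\pm$ extends by continuity to $\widehat{\mathcal{M}}_\pm$, and one sets $[f,g]_1:=[f_{\widehat{\mathcal{M}}_+},g_{\widehat{\mathcal{M}}_+}]+[f_{\widehat{\mathcal{M}}_-},g_{\widehat{\mathcal{M}}_-}]$ for $f,g\in\widehat{\mathfrak{H}}$ (components in $\widehat{\mathcal{M}}_\pm$). Energetic linear manifold: let $J_{\mathcal{M}}(f_{\mathcal{M}_+}+f_{\mathcal{M}_-})=f_{\mathcal{M}_+}-f_{\mathcal{M}_-}$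 with domain $\mathcal{D}$. Since $\mathcal{M}_\pm$ are maximal definite and $J$-orthogonal, $JJ_{\mathcal{M}}$ is a positive self-adjoint operator in $(\mathfrak{H},(\cdot,\cdot))$, written $e^Q=JJ_{\mathcal{M}}$ with $Q$ self-adjoint, and $(f,f)_1=(e^Qf,f)$ on $\mathcal{D}$. $\mathfrak{D}$ is the completion of $\mathcal{D}$ in the energetic norm $\|f\|_{en}^2=\|f\|^2+\|f\|_1^2$; it is identified with the subset $\mathcal{D}(e^{Q/2})$ of $\mathfrak{H}$, and, via the continuous extension of the inclusion $\mathcal{D}\subset\widehat{\mathfrak{H}}$, also with a subset of $\widehat{\mathfrak{H}}$ ($\mathfrak{D}=\mathfrak{H}\cap\widehat{\mathfrak{H}}$). On $\mathfrak{D}$ the forms $[\cdot,\cdot]$ and $[\cdot,\cdot]_1$ coincide. *)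

theory Defs
  imports "HOL-Analysis.Analysis"
begin

section \<open>Complex inner product spaces on a carrier\<close>

text \<open>The carrier is a linear subspace of an ambient complex vector space; sesquilinear forms are
  linear in the first argument.\<close>

record 'a inner_space =
  carr :: "'a set"
  scl :: "complex \<Rightarrow> 'a \<Rightarrow> 'a"
  inn :: "'a \<Rightarrow> 'a \<Rightarrow> complex"

definition hermitian_form_on :: "(complex \<Rightarrow> 'a \<Rightarrow> 'a) \<Rightarrow> 'a::ab_group_add set \<Rightarrow> ('a \<Rightarrow> 'a \<Rightarrow> complex) \<Rightarrow> bool" where
  "hermitian_form_on s V b \<longleftrightarrow>
     (\<forall>f\<in>V. \<forall>g\<in>V. \<forall>h\<in>V. b (f + g) h = b f h + b g h) \<and>
     (\<forall>c. \<forall>f\<in>V. \<forall>g\<in>V. b (s c f) g = c * b f g) \<and>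
     (\<forall>f\<in>V. \<forall>g\<in>V. b g f = cnj (b f g))"

definition inner_product_space :: "'a::ab_group_add inner_space \<Rightarrow> bool" where
  "inner_product_space X \<longleftrightarrow>
     vector_space (scl X) \<and> module.subspace (scl X) (carr X) \<and>
     hermitian_form_on (scl X) (carr X) (inn X) \<and>
     (\<forall>f\<in>carr X. f \<noteq> 0 \<longrightarrow> 0 < Re (inn X f f))"

definition inn_norm :: "'a inner_space \<Rightarrow> 'a \<Rightarrow> real" where
  "inn_norm X f = sqrt (Re (inn X f f))"

text \<open>The value off the carrier is immaterial; 0 is chosen since the locale \<open>Metric_space\<close> requires
  the distance to be nonnegative and symmetric on the whole type.\<close>

definition inn_dist :: "'a::ab_group_add inner_space \<Rightarrow> 'a \<Rightarrow> 'a \<Rightarrow> real" where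
  "inn_dist X f g = (if f \<in> carr X \<and> g \<in> carr X then inn_norm X (f - g) else 0)"

definition inn_topology :: "'a::ab_group_add inner_space \<Rightarrow> 'a topology" where
  "inn_topology X = Metric_space.mtopology (carr X) (inn_dist X)"

definition hilbert_space :: "'a::ab_group_add inner_space \<Rightarrow> bool" where
  "hilbert_space X \<longleftrightarrow>
     inner_product_space X \<and> Metric_space.mcomplete (carr X) (inn_dist X)"

definition converges_in :: "'a::ab_group_add inner_space \<Rightarrow> (nat \<Rightarrow> 'a) \<Rightarrow> 'a \<Rightarrow> bool" where
  "converges_in X x l \<longleftrightarrow> limitin (inn_topology X) x l sequentially"

definition sums_in :: "'a::ab_group_add inner_space \<Rightarrow> (nat \<Rightarrow> 'a) \<Rightarrow> 'a \<Rightarrow> bool" where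
  "sums_in X x l \<longleftrightarrow> converges_in X (\<lambda>N. \<Sum>n<N. x n) l"

definition is_completion :: "'a::ab_group_add inner_space \<Rightarrow> 'b::ab_group_add inner_space \<Rightarrow> ('a \<Rightarrow> 'b) \<Rightarrow> bool" where
  "is_completion X H \<iota> \<longleftrightarrow>
     inner_product_space X \<and> hilbert_space H \<and>
     \<iota> ` carr X \<subseteq> carr H \<and>
     (\<forall>f\<in>carr X. \<forall>g\<in>carr X. \<iota> (f + g) = \<iota> f + \<iota> g) \<and>
     (\<forall>c. \<forall>f\<in>carr X. \<iota> (scl X c f) = scl H c (\<iota> f)) \<and>
     (\<forall>f\<in>carr X. \<forall>g\<in>carr X. inn H (\<iota> f) (\<iota> g) = inn X f g) \<and>
     inn_topology H closure_of (\<iota> ` carr X) = carr H"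

definition boundedly_invertible :: "'a::ab_group_add inner_space \<Rightarrow> ('a \<Rightarrow> 'a) \<Rightarrow> bool" where
  "boundedly_invertible X T \<longleftrightarrow>
     (\<forall>f\<in>carr X. \<forall>g\<in>carr X. T (f + g) = T f + T g) \<and>
     (\<forall>c. \<forall>f\<in>carr X. T (scl X c f) = scl X c (T f)) \<and>
     bij_betw T (carr X) (carr X) \<and>
     (\<exists>C. \<forall>h\<in>carr X. inn_norm X (the_inv_into (carr X) T h) \<le> C * inn_norm X h)"

text \<open>The component in \<open>A\<close> of \<open>f\<close> with respect to a direct sum decomposition into \<open>A\<close> and \<open>B\<close>.\<close>

definition component :: "'a::ab_group_add set \<Rightarrow> 'a set \<Rightarrow> 'a \<Rightarrow> 'a" where
  "component A B f = (THE u. u \<in> A \<and> f - u \<in> B)"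


section \<open>Krein spaces with a fixed fundamental decomposition\<close>

record 'a krein =
  scal :: "complex \<Rightarrow> 'a \<Rightarrow> 'a"
  form :: "'a \<Rightarrow> 'a \<Rightarrow> complex"
  pos_part :: "'a set"
  neg_part :: "'a set"

definition krein_space :: "'a::ab_group_add krein \<Rightarrow> bool" where
  "krein_space K \<longleftrightarrow>
     vector_space (scal K) \<and>
     (\<nexists>E. finite E \<and> module.span (scal K) E = UNIV) \<and>
     hermitian_form_on (scal K) UNIV (form K) \<and>
     pos_part K \<inter> neg_part K = {0} \<and>
     {u + v | u v. u \<in> pos_part K \<and> v \<in> neg_part K} = UNIV \<and>
     (\<forall>u\<in>pos_part K. \<forall>v\<in>neg_part K. form K u v = 0) \<and>
     hilbert_space \<lparr>carr = pos_part K, scl = scal K, inn = form K\<rparr> \<and>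
     hilbert_space \<lparr>carr = neg_part K, scl = scal K, inn = (\<lambda>f g. - form K f g)\<rparr>"

definition fund_symmetry :: "'a::ab_group_add krein \<Rightarrow> 'a \<Rightarrow> 'a" where
  "fund_symmetry K f =
     component (pos_part K) (neg_part K) f - component (neg_part K) (pos_part K) f"

definition krein_hilbert :: "'a::ab_group_add krein \<Rightarrow> 'a inner_space" where
  "krein_hilbert K =
     \<lparr>carr = UNIV, scl = scal K, inn = (\<lambda>f g. form K (fund_symmetry K f) g)\<rparr>"

definition closed_subspace :: "'a::ab_group_add krein \<Rightarrow> 'a set \<Rightarrow> bool" where
  "closed_subspace K L \<longleftrightarrow>
     module.subspace (scal K) L \<and> closedin (inn_topology (krein_hilbert K)) L"

definition positive_subspace :: "'a::ab_group_add krein \<Rightarrow> 'a set \<Rightarrow> bool" where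
  "positive_subspace K L \<longleftrightarrow>
     closed_subspace K L \<and> (\<forall>f\<in>L. f \<noteq> 0 \<longrightarrow> 0 < Re (form K f f))"

definition negative_subspace :: "'a::ab_group_add krein \<Rightarrow> 'a set \<Rightarrow> bool" where
  "negative_subspace K L \<longleftrightarrow>
     closed_subspace K L \<and> (\<forall>f\<in>L. f \<noteq> 0 \<longrightarrow> Re (form K f f) < 0)"

definition maximal_positive :: "'a::ab_group_add krein \<Rightarrow> 'a set \<Rightarrow> bool" where
  "maximal_positive K L \<longleftrightarrow>
     positive_subspace K L \<and> (\<nexists>L'. positive_subspace K L' \<and> L \<subset> L')"

definition maximal_negative :: "'a::ab_group_add krein \<Rightarrow> 'a set \<Rightarrow> bool" where
  "maximal_negative K L \<longleftrightarrow>
     negative_subspace K L \<and> (\<nexists>L'. negative_subspace K L' \<and> L \<subset> L')"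

definition J_orthogonal :: "'a krein \<Rightarrow> 'a set \<Rightarrow> 'a set \<Rightarrow> bool" where
  "J_orthogonal K L1 L2 \<longleftrightarrow> (\<forall>f\<in>L1. \<forall>g\<in>L2. form K f g = 0)"


section \<open>\<open>J\<close>-frames\<close>

definition N_plus :: "'a krein \<Rightarrow> (nat \<Rightarrow> 'a) \<Rightarrow> nat set" where
  "N_plus K F = {n. 0 \<le> Re (form K (F n) (F n))}"

definition N_minus :: "'a krein \<Rightarrow> (nat \<Rightarrow> 'a) \<Rightarrow> nat set" where
  "N_minus K F = {n. Re (form K (F n) (F n)) < 0}"

definition M_plus :: "'a::ab_group_add krein \<Rightarrow> (nat \<Rightarrow> 'a) \<Rightarrow> 'a set" where
  "M_plus K F =
     inn_topology (krein_hilbert K) closure_of module.span (scal K) (F ` N_plus K F)"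

definition M_minus :: "'a::ab_group_add krein \<Rightarrow> (nat \<Rightarrow> 'a) \<Rightarrow> 'a set" where
  "M_minus K F =
     inn_topology (krein_hilbert K) closure_of module.span (scal K) (F ` N_minus K F)"

definition frame_bounds :: "'a::ab_group_add krein \<Rightarrow> (nat \<Rightarrow> 'a) \<Rightarrow> nat set \<Rightarrow> real \<Rightarrow> real \<Rightarrow> bool" where
  "frame_bounds K F N A B \<longleftrightarrow>
     (\<forall>f\<in>module.span (scal K) (F ` N).
        (\<lambda>n. (cmod (form K f (F n)))\<^sup>2) summable_on N \<and>
        A * cmod (form K f f) \<le> (\<Sum>\<^sub>\<infinity>n\<in>N. (cmod (form K f (F n)))\<^sup>2) \<and>
        (\<Sum>\<^sub>\<infinity>n\<in>N. (cmod (form K f (F n)))\<^sup>2) \<le> B * cmod (form K f f))"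

definition J_frame :: "'a::ab_group_add krein \<Rightarrow> (nat \<Rightarrow> 'a) \<Rightarrow> bool" where
  "J_frame K F \<longleftrightarrow>
     maximal_positive K (M_plus K F) \<and> maximal_negative K (M_minus K F) \<and>
     (\<exists>A B. 0 < A \<and> A \<le> B \<and>
        frame_bounds K F (N_plus K F) A B \<and> frame_bounds K F (N_minus K F) A B)"

definition D_sum :: "'a::ab_group_add krein \<Rightarrow> (nat \<Rightarrow> 'a) \<Rightarrow> 'a set" where
  "D_sum K F = {u + v | u v. u \<in> M_plus K F \<and> v \<in> M_minus K F}"

definition D_space :: "'a::ab_group_add krein \<Rightarrow> (nat \<Rightarrow> 'a) \<Rightarrow> 'a inner_space" where
  "D_space K F =
     (let p = component (M_plus K F) (M_minus K F); m = component (M_minus K F) (M_plus K F)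
      in \<lparr>carr = D_sum K F, scl = scal K,
          inn = (\<lambda>f g. form K (p f) (p g) - form K (m f) (m g))\<rparr>)"


section \<open>The form and the frame operator on the completion\<close>

text \<open>Below, \<open>H\<close> with embedding \<open>\<iota>\<close> is any completion of \<open>D_space K F\<close>. The closure in \<open>H\<close> of the
  image of \<open>M_plus K F\<close> (resp.\ \<open>M_minus K F\<close>) is its completion with respect to \<open>form K\<close>
  (resp.\ \<open>- form K\<close>), because \<open>\<iota>\<close> is isometric.\<close>

definition closure_image :: "'b::ab_group_add inner_space \<Rightarrow> ('a \<Rightarrow> 'b) \<Rightarrow> 'a set \<Rightarrow> 'b set" where
  "closure_image H \<iota> M = inn_topology H closure_of (\<iota> ` M)"

text \<open>Extension by continuity of \<open>form K\<close> from \<open>M\<close> to \<open>closure_image H \<iota> M\<close>.\<close>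

definition ext_form :: "'a krein \<Rightarrow> 'b::ab_group_add inner_space \<Rightarrow> ('a \<Rightarrow> 'b) \<Rightarrow> 'a set \<Rightarrow> 'b \<Rightarrow> 'b \<Rightarrow> complex" where
  "ext_form K H \<iota> M f g =
     (THE c. \<forall>x y. range x \<subseteq> M \<and> range y \<subseteq> M \<and>
        converges_in H (\<lambda>n. \<iota> (x n)) f \<and> converges_in H (\<lambda>n. \<iota> (y n)) g \<longrightarrow>
        (\<lambda>n. form K (x n) (y n)) \<longlonglongrightarrow> c)"

definition form1 :: "'a::ab_group_add krein \<Rightarrow> (nat \<Rightarrow> 'a) \<Rightarrow> 'b::ab_group_add inner_space \<Rightarrow> ('a \<Rightarrow> 'b) \<Rightarrow> 'b \<Rightarrow> 'b \<Rightarrow> complex" where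
  "form1 K F H \<iota> f g =
     (let P = closure_image H \<iota> (M_plus K F); N = closure_image H \<iota> (M_minus K F)
      in ext_form K H \<iota> (M_plus K F) (component P N f) (component P N g) +
         ext_form K H \<iota> (M_minus K F) (component N P f) (component N P g))"

definition frame_operator :: "'a::ab_group_add krein \<Rightarrow> (nat \<Rightarrow> 'a) \<Rightarrow> 'b::ab_group_add inner_space \<Rightarrow> ('a \<Rightarrow> 'b) \<Rightarrow> 'b \<Rightarrow> 'b" where
  "frame_operator K F H \<iota> f =
     (THE h. sums_in H (\<lambda>n. scl H (form1 K F H \<iota> f (\<iota> (F n))) (\<iota> (F n))) h)"


section \<open>The energetic linear manifold\<close>

definition en_dist :: "'a::ab_group_add krein \<Rightarrow> (nat \<Rightarrow> 'a) \<Rightarrow> 'a \<Rightarrow> 'a \<Rightarrow> real" where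
  "en_dist K F f g =
     sqrt ((inn_dist (krein_hilbert K) f g)\<^sup>2 + (inn_dist (D_space K F) f g)\<^sup>2)"

text \<open>The completion of \<open>D_sum K F\<close> in the energetic norm, realized in the Krein space by sending
  (the class of) an energetic Cauchy sequence to its limit in the Hilbert norm. Sending it to
  its limit in \<open>H\<close> gives the inclusion of the energetic manifold into \<open>H\<close>.\<close>

definition en_approx :: "'a::ab_group_add krein \<Rightarrow> (nat \<Rightarrow> 'a) \<Rightarrow> (nat \<Rightarrow> 'a) \<Rightarrow> 'a \<Rightarrow> bool" where
  "en_approx K F x f \<longleftrightarrow>
     Metric_space.MCauchy (D_sum K F) (en_dist K F) x \<and> converges_in (krein_hilbert K) x f"

definition energetic_manifold :: "'a::ab_group_add krein \<Rightarrow> (nat \<Rightarrow> 'a) \<Rightarrow> 'a set" where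
  "energetic_manifold K F = {f. \<exists>x. en_approx K F x f}"

definition en_inclusion :: "'a::ab_group_add krein \<Rightarrow> (nat \<Rightarrow> 'a) \<Rightarrow> 'b::ab_group_add inner_space \<Rightarrow> ('a \<Rightarrow> 'b) \<Rightarrow> 'a \<Rightarrow> 'b" where
  "en_inclusion K F H \<iota> f =
     (THE h. \<forall>x. en_approx K F x f \<longrightarrow> converges_in H (\<lambda>n. \<iota> (x n)) h)"

end

theory Submission
  imports Defs
begin

text \<open>Write \<open>J\<^sub>1\<close> for the fundamental symmetry of the completion \<open>H\<close>. The form on \<open>H\<close> is
  \<open>[f, g]\<^sub>1 = (J\<^sub>1 f, g)\<^sub>1\<close>, so the frame operator of the theorem is \<open>S = T \<circ> J\<^sub>1\<close>, where \<open>T\<close> is the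
  ordinary frame operator of \<open>(\<iota> f\<^sub>n)\<close> in the Hilbert space \<open>H\<close>. The two families of \<open>J\<close>-frame
  inequalities add up to the frame inequalities for \<open>(\<iota> f\<^sub>n)\<close> on a dense set; hence \<open>T\<close> is bounded
  and coercive, thus boundedly invertible, and so is \<open>S\<close>. Applying \<open>S\<^sup>-\<^sup>1\<close> termwise to the series
  of \<open>S h\<close> gives the expansion of every \<open>h \<in> H\<close>. If \<open>h\<close> is the image of \<open>f\<close> in the energetic
  manifold, then \<open>[f, z] = (J\<^sub>1 h, \<iota> z)\<^sub>1\<close> for \<open>z \<in> D\<close> by approximation, which both identifies the
  coefficients and shows that \<open>h\<close> is determined by \<open>f\<close>.\<close>

section \<open>Inner product spaces and Hilbert spaces on a carrier\<close>

lemma LIMSEQ_null_squeeze: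
  fixes f g :: "nat \<Rightarrow> real"
  assumes "g \<longlonglongrightarrow> 0" "\<And>n. 0 \<le> f n" "\<And>n. f n \<le> g n"
  shows "f \<longlonglongrightarrow> 0"
  by (rule tendsto_sandwich[OF _ _ tendsto_const assms(1)]) (use assms in \<open>auto intro!: always_eventually\<close>)

section \<open>Algebra of the inner product and its norm\<close>

locale ip_space =
  fixes X :: "'a::ab_group_add inner_space"
  assumes inner_product_space: "inner_product_space X"
begin

sublocale vector_space "scl X"
  using inner_product_space unfolding inner_product_space_def by blast

abbreviation V where "V \<equiv> carr X"

lemma subspace_V: "subspace V"
  using inner_product_space unfolding inner_product_space_def by blast

lemmas V_closed [simp, intro] =
  subspace_0[OF subspace_V] subspace_add[OF subspace_V] subspace_diff[OF subspace_V]
  subspace_scale[OF subspace_V] subspace_neg[OF subspace_V] subspace_sum[OF subspace_V]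

lemma hermitian: "hermitian_form_on (scl X) V (inn X)"
  using inner_product_space unfolding inner_product_space_def by blast

lemma inn_add_left: "f \<in> V \<Longrightarrow> g \<in> V \<Longrightarrow> h \<in> V \<Longrightarrow> inn X (f + g) h = inn X f h + inn X g h"
  using hermitian unfolding hermitian_form_on_def by blast

lemma inn_scale_left: "f \<in> V \<Longrightarrow> g \<in> V \<Longrightarrow> inn X (scl X c f) g = c * inn X f g"
  using hermitian unfolding hermitian_form_on_def by blast

lemma inn_commute: "f \<in> V \<Longrightarrow> g \<in> V \<Longrightarrow> inn X g f = cnj (inn X f g)"
  using hermitian unfolding hermitian_form_on_def by blast

lemma inn_pos: "f \<in> V \<Longrightarrow> f \<noteq> 0 \<Longrightarrow> 0 < Re (inn X f f)"
  using inner_product_space unfolding inner_product_space_def by blast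

lemma inn_add_right: "f \<in> V \<Longrightarrow> g \<in> V \<Longrightarrow> h \<in> V \<Longrightarrow> inn X h (f + g) = inn X h f + inn X h g"
  by (metis inn_add_left inn_commute complex_cnj_add V_closed(2))

lemma inn_scale_right: "f \<in> V \<Longrightarrow> g \<in> V \<Longrightarrow> inn X g (scl X c f) = cnj c * inn X g f"
  by (metis inn_scale_left inn_commute complex_cnj_mult V_closed(4))

lemma inn_zero_left [simp]: "f \<in> V \<Longrightarrow> inn X 0 f = 0"
  using inn_add_left[of 0 0 f] by simp

lemma inn_zero_right [simp]: "f \<in> V \<Longrightarrow> inn X f 0 = 0"
  using inn_add_right[of 0 0 f] by simp

lemma inn_diff_left: "f \<in> V \<Longrightarrow> g \<in> V \<Longrightarrow> h \<in> V \<Longrightarrow> inn X (f - g) h = inn X f h - inn X g h"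
  using inn_add_left[of "f - g" g h] by simp

lemma inn_diff_right: "f \<in> V \<Longrightarrow> g \<in> V \<Longrightarrow> h \<in> V \<Longrightarrow> inn X h (f - g) = inn X h f - inn X h g"
  using inn_add_right[of "f - g" g h] by simp

lemma inn_sum_left:
  "(\<And>i. i \<in> I \<Longrightarrow> f i \<in> V) \<Longrightarrow> h \<in> V \<Longrightarrow> inn X (\<Sum>i\<in>I. f i) h = (\<Sum>i\<in>I. inn X (f i) h)"
  by (induction I rule: infinite_finite_induct) (auto simp: inn_add_left)

lemma Im_inn_self [simp]: "f \<in> V \<Longrightarrow> Im (inn X f f) = 0"
  using inn_commute[of f f] by (metis complex_cnj_cancel_iff complex_eq_iff cnj.simps(2) neg_equal_zero)

lemma inn_self_nonneg: "f \<in> V \<Longrightarrow> 0 \<le> Re (inn X f f)"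
  using inn_pos[of f] by (cases "f = 0") auto

lemma inn_norm_nonneg [simp]: "f \<in> V \<Longrightarrow> 0 \<le> inn_norm X f"
  by (simp add: inn_norm_def inn_self_nonneg)

lemma inn_norm_sq: "f \<in> V \<Longrightarrow> (inn_norm X f)\<^sup>2 = Re (inn X f f)"
  by (simp add: inn_norm_def inn_self_nonneg)

lemma inn_self: "f \<in> V \<Longrightarrow> inn X f f = of_real ((inn_norm X f)\<^sup>2)"
  by (simp add: complex_eq_iff inn_norm_sq)

lemma inn_norm_eq_0 [simp]: "f \<in> V \<Longrightarrow> inn_norm X f = 0 \<longleftrightarrow> f = 0"
  using inn_pos[of f] by (force simp: inn_norm_def)

lemma inn_norm_zero [simp]: "inn_norm X 0 = 0"
  by simp

lemma inn_norm_scale: "f \<in> V \<Longrightarrow> inn_norm X (scl X c f) = cmod c * inn_norm X f"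
proof -
  assume f: "f \<in> V"
  have "inn X (scl X c f) (scl X c f) = (c * cnj c) * inn X f f"
    using f by (simp add: inn_scale_left inn_scale_right)
  also have "\<dots> = of_real ((cmod c)\<^sup>2 * (inn_norm X f)\<^sup>2)"
    using f by (simp add: inn_self flip: complex_norm_square)
  finally show ?thesis
    using f by (simp add: inn_norm_def[of X "scl X c f"] real_sqrt_mult)
qed

lemma inn_norm_minus [simp]: "f \<in> V \<Longrightarrow> inn_norm X (- f) = inn_norm X f"
  using inn_norm_scale[of f "-1"] by simp

lemma inn_norm_diff_commute: "f \<in> V \<Longrightarrow> g \<in> V \<Longrightarrow> inn_norm X (f - g) = inn_norm X (g - f)"
  by (metis inn_norm_minus minus_diff_eq V_closed(3))

lemma inn_norm_diff_sq:
  assumes "f \<in> V" "g \<in> V"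
  shows "(inn_norm X (f - g))\<^sup>2 = (inn_norm X f)\<^sup>2 - 2 * Re (inn X f g) + (inn_norm X g)\<^sup>2"
proof -
  have "Re (inn X g f) = Re (inn X f g)"
    using assms inn_commute[of f g] by simp
  then show ?thesis
    using assms by (simp add: inn_norm_sq inn_diff_left inn_diff_right)
qed

lemma Cauchy_Schwarz:
  assumes f: "f \<in> V" and g: "g \<in> V"
  shows "cmod (inn X f g) \<le> inn_norm X f * inn_norm X g"
proof (cases "g = 0")
  case True
  then show ?thesis using f by simp
next
  case False
  define G where "G = (inn_norm X g)\<^sup>2"
  have G: "G > 0" using False g unfolding G_def by simp
  \<comment> \<open>\<open>scl X t g\<close> is the orthogonal projection of \<open>f\<close> onto
    the line through \<open>g\<close>; the inequality says that the remainder has nonnegative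
    squared norm.\<close>
  define t where "t = inn X f g / of_real G"
  have "inn X f (scl X t g) = of_real ((cmod (inn X f g))\<^sup>2 / G)"
    using f g by (simp add: inn_scale_right t_def mult.commute flip: complex_norm_square)
  moreover have "(inn_norm X (scl X t g))\<^sup>2 = (cmod (inn X f g))\<^sup>2 / G"
    using g G by (simp add: inn_norm_scale t_def norm_divide power_mult_distrib power_divide
        flip: G_def) (simp add: power2_eq_square)
  ultimately have "(inn_norm X (f - scl X t g))\<^sup>2 = (inn_norm X f)\<^sup>2 - (cmod (inn X f g))\<^sup>2 / G"
    using f g by (simp add: inn_norm_diff_sq)
  then have "(cmod (inn X f g))\<^sup>2 / G \<le> (inn_norm X f)\<^sup>2"
    by (metis diff_ge_0_iff_ge zero_le_power2)
  then have "(cmod (inn X f g))\<^sup>2 \<le> (inn_norm X f * inn_norm X g)\<^sup>2"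
    using G by (simp add: G_def power_mult_distrib divide_le_eq)
  then show ?thesis
    using f g by (meson power2_le_imp_le inn_norm_nonneg mult_nonneg_nonneg)
qed

lemma inn_norm_triangle:
  assumes f: "f \<in> V" and g: "g \<in> V"
  shows "inn_norm X (f + g) \<le> inn_norm X f + inn_norm X g"
proof -
  have "(inn_norm X (f - (- g)))\<^sup>2 = (inn_norm X f)\<^sup>2 - 2 * Re (inn X f (- g)) + (inn_norm X g)\<^sup>2"
    using f g by (subst inn_norm_diff_sq) auto
  moreover have "- Re (inn X f (- g)) \<le> inn_norm X f * inn_norm X g"
    using Cauchy_Schwarz[of f "- g"] abs_Re_le_cmod[of "inn X f (- g)"] f g by auto
  ultimately have "(inn_norm X (f + g))\<^sup>2 \<le> (inn_norm X f + inn_norm X g)\<^sup>2"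
    by (simp add: power2_sum)
  then show ?thesis
    using f g by (meson power2_le_imp_le inn_norm_nonneg add_nonneg_nonneg)
qed

lemma inn_norm_diff_triangle:
  assumes "f \<in> V" "g \<in> V" "h \<in> V"
  shows "inn_norm X (f - h) \<le> inn_norm X (f - g) + inn_norm X (g - h)"
  using inn_norm_triangle[of "f - g" "g - h"] assms by simp

lemma inn_norm_sum:
  "(\<And>i. i \<in> I \<Longrightarrow> f i \<in> V) \<Longrightarrow> inn_norm X (\<Sum>i\<in>I. f i) \<le> (\<Sum>i\<in>I. inn_norm X (f i))"
proof (induction I rule: infinite_finite_induct)
  case (insert i I)
  then show ?case
    using inn_norm_triangle[of "f i" "\<Sum>i\<in>I. f i"] by auto
qed auto

section \<open>The norm metric, convergence and closures\<close>

sublocale M: Metric_space V "inn_dist X"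
proof
  show "0 \<le> inn_dist X f g" for f g
    by (simp add: inn_dist_def)
  show "inn_dist X f g = inn_dist X g f" for f g
    by (auto simp: inn_dist_def inn_norm_diff_commute)
  show "inn_dist X f g = 0 \<longleftrightarrow> f = g" if "f \<in> V" "g \<in> V" for f g
    using that by (simp add: inn_dist_def)
  show "inn_dist X f h \<le> inn_dist X f g + inn_dist X g h" if "f \<in> V" "g \<in> V" "h \<in> V" for f g h
    using that inn_norm_diff_triangle by (simp add: inn_dist_def)
qed

text \<open>Brings topological limits down to real null sequences, the form used in all later
  convergence arguments. The sequence has to stay in the carrier because \<open>inn_dist\<close> is
  set to 0 off it.\<close>

lemma converges_in_iff:
  assumes "\<And>n. x n \<in> V"
  shows "converges_in X x l \<longleftrightarrow> l \<in> V \<and> (\<lambda>n. inn_norm X (x n - l)) \<longlonglongrightarrow> 0"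
  using assms unfolding converges_in_def inn_topology_def M.limitin_metric_dist_null inn_dist_def
  by auto

lemma converges_in_V: "converges_in X x l \<Longrightarrow> l \<in> V"
  unfolding converges_in_def inn_topology_def M.limitin_metric by blast

lemma converges_in_unique: "converges_in X x l \<Longrightarrow> converges_in X x m \<Longrightarrow> l = m"
  unfolding converges_in_def inn_topology_def by (rule M.limitin_metric_unique) auto

lemma converges_in_const [simp]: "f \<in> V \<Longrightarrow> converges_in X (\<lambda>_. f) f"
  by (simp add: converges_in_iff)

lemma converges_in_add:
  assumes x: "\<And>n. x n \<in> V" and y: "\<And>n. y n \<in> V"
    and xl: "converges_in X x l" and ym: "converges_in X y m"
  shows "converges_in X (\<lambda>n. x n + y n) (l + m)"
proof -
  have l: "l \<in> V" "(\<lambda>n. inn_norm X (x n - l)) \<longlonglongrightarrow> 0"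
    and m: "m \<in> V" "(\<lambda>n. inn_norm X (y n - m)) \<longlonglongrightarrow> 0"
    using xl ym x y by (auto simp: converges_in_iff)
  have "(\<lambda>n. inn_norm X (x n + y n - (l + m))) \<longlonglongrightarrow> 0"
  proof (rule LIMSEQ_null_squeeze[OF tendsto_add_zero[OF l(2) m(2)]])
    show "inn_norm X (x n + y n - (l + m)) \<le> inn_norm X (x n - l) + inn_norm X (y n - m)" for n
      using inn_norm_triangle[of "x n - l" "y n - m"] x y l(1) m(1)
      by (simp add: add_diff_add)
  qed (use x y l(1) m(1) in simp)
  then show ?thesis
    using x y l(1) m(1) by (simp add: converges_in_iff)
qed

lemma converges_in_scale:
  assumes x: "\<And>n. x n \<in> V" and xl: "converges_in X x l"
  shows "converges_in X (\<lambda>n. scl X c (x n)) (scl X c l)"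
proof -
  have l: "l \<in> V" "(\<lambda>n. inn_norm X (x n - l)) \<longlonglongrightarrow> 0"
    using xl x by (auto simp: converges_in_iff)
  have "(\<lambda>n. cmod c * inn_norm X (x n - l)) \<longlonglongrightarrow> 0"
    using tendsto_mult_left[OF l(2), of "cmod c"] by simp
  then show ?thesis
    using x l(1) by (simp add: converges_in_iff inn_norm_scale flip: scale_right_diff_distrib)
qed

lemma converges_in_diff:
  assumes x: "\<And>n. x n \<in> V" and y: "\<And>n. y n \<in> V"
    and xl: "converges_in X x l" and ym: "converges_in X y m"
  shows "converges_in X (\<lambda>n. x n - y n) (l - m)"
  using converges_in_add[OF x _ xl converges_in_scale[OF y ym, of "-1"]] y by simp

lemma converges_in_inn:
  assumes x: "\<And>n. x n \<in> V" and y: "\<And>n. y n \<in> V"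
    and xl: "converges_in X x l" and ym: "converges_in X y m"
  shows "(\<lambda>n. inn X (x n) (y n)) \<longlonglongrightarrow> inn X l m"
proof -
  have l: "l \<in> V" "(\<lambda>n. inn_norm X (x n - l)) \<longlonglongrightarrow> 0"
    and m: "m \<in> V" "(\<lambda>n. inn_norm X (y n - m)) \<longlonglongrightarrow> 0"
    using xl ym x y by (auto simp: converges_in_iff)
  \<comment> \<open>The three terms arise from writing \<open>x n = (x n - l) + l\<close> and
    \<open>y n = (y n - m) + m\<close>, expanding, and applying Cauchy-Schwarz to everything except
    the limit itself.\<close>
  define e where "e n = inn_norm X (x n - l) * inn_norm X (y n - m)
      + inn_norm X (x n - l) * inn_norm X m + inn_norm X l * inn_norm X (y n - m)" for n
  have "e \<longlonglongrightarrow> 0 * 0 + 0 * inn_norm X m + inn_norm X l * 0"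
    unfolding e_def by (intro tendsto_intros l m)
  then have e: "e \<longlonglongrightarrow> 0" by simp
  have "norm (inn X (x n) (y n) - inn X l m) \<le> e n" for n
  proof -
    have "inn X (x n) (y n) - inn X l m = inn X (x n - l) (y n - m) + inn X (x n - l) m
        + inn X l (y n - m)"
      using x y l(1) m(1) by (simp add: inn_diff_left inn_diff_right)
    then have "norm (inn X (x n) (y n) - inn X l m)
        \<le> norm (inn X (x n - l) (y n - m)) + norm (inn X (x n - l) m) + norm (inn X l (y n - m))"
      by (metis norm_add_rule_thm norm_triangle_mono norm_triangle_ineq order_refl)
    also have "\<dots> \<le> e n"
      unfolding e_def using x y l(1) m(1) by (intro add_mono Cauchy_Schwarz) auto
    finally show ?thesis .
  qed
  then have "(\<lambda>n. inn X (x n) (y n) - inn X l m) \<longlonglongrightarrow> 0"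
    by (intro Lim_null_comparison[OF _ e] always_eventually) blast
  then show ?thesis
    by (simp add: LIM_zero_iff)
qed

lemma converges_in_norm:
  assumes x: "\<And>n. x n \<in> V" and xl: "converges_in X x l"
  shows "(\<lambda>n. inn_norm X (x n)) \<longlonglongrightarrow> inn_norm X l"
  unfolding inn_norm_def by (intro tendsto_intros converges_in_inn assms)

text \<open>Continuity of a bounded operator. Compatibility with differences is the form of
  additivity that turns \<open>T (x n) - T l\<close> into \<open>T (x n - l)\<close>. It is applied
  to frame operators, to inverses and to \<open>J1\<close>.\<close>

lemma converges_in_bounded_image:
  assumes T: "\<And>f. f \<in> V \<Longrightarrow> T f \<in> V" "\<And>f g. f \<in> V \<Longrightarrow> g \<in> V \<Longrightarrow> T (f - g) = T f - T g"
    and bound: "\<And>f. f \<in> V \<Longrightarrow> inn_norm X (T f) \<le> C * inn_norm X f"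
    and x: "\<And>n. x n \<in> V" and xl: "converges_in X x l"
  shows "converges_in X (\<lambda>n. T (x n)) (T l)"
proof -
  have l: "l \<in> V" "(\<lambda>n. inn_norm X (x n - l)) \<longlonglongrightarrow> 0"
    using xl x by (auto simp: converges_in_iff)
  have "(\<lambda>n. C * inn_norm X (x n - l)) \<longlonglongrightarrow> 0"
    using tendsto_mult_left[OF l(2), of C] by simp
  then have "(\<lambda>n. inn_norm X (T (x n - l))) \<longlonglongrightarrow> 0"
    by (rule LIMSEQ_null_squeeze) (use x l(1) T(1) bound in simp_all)
  then show ?thesis
    using x l(1) T by (simp add: converges_in_iff)
qed

text \<open>Closures in a metric space are sequential: points are picked from balls of radius
  1/(n+1). This turns density and closedness into statements about approximating sequences.\<close>

lemma in_closure_of_iff: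
  assumes "A \<subseteq> V"
  shows "l \<in> inn_topology X closure_of A \<longleftrightarrow> (\<exists>x. range x \<subseteq> A \<and> converges_in X x l)"
proof
  assume "l \<in> inn_topology X closure_of A"
  then have l: "l \<in> V" and ball: "\<forall>r>0. \<exists>y\<in>A. y \<in> M.mball l r"
    by (auto simp: inn_topology_def M.metric_closure_of)
  then have near: "\<exists>y\<in>A. inn_norm X (y - l) < r" if r: "r > 0" for r
  proof -
    obtain y where "y \<in> A" "y \<in> V" "inn_dist X l y < r"
      using ball r unfolding M.in_mball by blast
    then show ?thesis
      using l by (auto simp: inn_dist_def inn_norm_diff_commute[of l])
  qed
  have "\<forall>n. \<exists>y\<in>A. inn_norm X (y - l) < inverse (real (Suc n))"
    using near by simp
  then obtain x where x: "\<And>n. x n \<in> A" "\<And>n. inn_norm X (x n - l) < inverse (real (Suc n))"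
    by metis
  have "(\<lambda>n. inn_norm X (x n - l)) \<longlonglongrightarrow> 0"
  proof (rule LIMSEQ_null_squeeze[OF LIMSEQ_inverse_real_of_nat])
    show "0 \<le> inn_norm X (x n - l)" for n
      using x(1)[of n] assms l by auto
  qed (use x(2) less_imp_le in blast)
  then show "\<exists>x. range x \<subseteq> A \<and> converges_in X x l"
    using x(1) l assms by (intro exI[of _ x]) (auto simp: converges_in_iff subset_iff)
next
  assume "\<exists>x. range x \<subseteq> A \<and> converges_in X x l"
  then obtain x :: "nat \<Rightarrow> 'a" where x: "range x \<subseteq> A" and l: "l \<in> V"
    and lim: "\<And>r. r > 0 \<Longrightarrow> \<exists>N. \<forall>n\<ge>N. x n \<in> V \<and> inn_dist X (x n) l < r"
    unfolding converges_in_def inn_topology_def M.limit_metric_sequentially by blast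
  have "\<exists>y\<in>A. y \<in> M.mball l r" if r: "r > 0" for r
  proof -
    obtain N where "x N \<in> V" "inn_dist X (x N) l < r"
      using lim[OF r] by blast
    then show ?thesis
      using x l M.commute[of l "x N"] by (intro bexI[of _ "x N"]) auto
  qed
  then show "l \<in> inn_topology X closure_of A"
    using l by (simp add: inn_topology_def M.metric_closure_of)
qed

lemma closure_of_subset_V: "inn_topology X closure_of A \<subseteq> V"
  unfolding inn_topology_def using closure_of_subset_topspace M.topspace_mtopology by metis

lemma subset_closure_of: "A \<subseteq> V \<Longrightarrow> A \<subseteq> inn_topology X closure_of A"
  unfolding inn_topology_def by (simp add: closure_of_subset)

lemma subspace_closure_of:
  assumes "subspace A" "A \<subseteq> V"
  shows "subspace (inn_topology X closure_of A)"
proof (rule subspaceI)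
  show "0 \<in> inn_topology X closure_of A"
    using assms subset_closure_of subspace_0 by blast
next
  fix f g assume "f \<in> inn_topology X closure_of A" "g \<in> inn_topology X closure_of A"
  then obtain x y where x: "range x \<subseteq> A" "converges_in X x f" and y: "range y \<subseteq> A" "converges_in X y g"
    using in_closure_of_iff[OF assms(2)] by blast
  then have "converges_in X (\<lambda>n. x n + y n) (f + g)"
    using assms by (intro converges_in_add) auto
  moreover have "range (\<lambda>n. x n + y n) \<subseteq> A"
    using x y assms by (auto intro!: subspace_add)
  ultimately show "f + g \<in> inn_topology X closure_of A"
    using in_closure_of_iff[OF assms(2)] by blast
next
  fix c f assume "f \<in> inn_topology X closure_of A"
  then obtain x where x: "range x \<subseteq> A" "converges_in X x f"
    using in_closure_of_iff[OF assms(2)] by blast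
  then have "converges_in X (\<lambda>n. scl X c (x n)) (scl X c f)"
    using assms by (intro converges_in_scale) auto
  moreover have "range (\<lambda>n. scl X c (x n)) \<subseteq> A"
    using x assms by (auto intro!: subspace_scale)
  ultimately show "scl X c f \<in> inn_topology X closure_of A"
    using in_closure_of_iff[OF assms(2)] by blast
qed

text \<open>Approximating \<open>f\<close> itself from \<open>A\<close>, the pairings with
  \<open>f\<close> are all 0 while their limit is the squared norm of \<open>f\<close>.\<close>

lemma eq_0_if_orthogonal_dense:
  assumes A: "A \<subseteq> V" "inn_topology X closure_of A = V" and f: "f \<in> V"
    and orth: "\<And>g. g \<in> A \<Longrightarrow> inn X f g = 0"
  shows "f = 0"
proof -
  obtain x where x: "range x \<subseteq> A" "converges_in X x f"
    using A f in_closure_of_iff by metis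
  then have "(\<lambda>n. inn X f (x n)) \<longlonglongrightarrow> inn X f f"
    using f A by (intro converges_in_inn) auto
  moreover have "(\<lambda>n. inn X f (x n)) = (\<lambda>n. 0)"
    using orth x by (simp add: image_subset_iff)
  ultimately have "inn X f f = 0"
    by (simp add: LIMSEQ_const_iff)
  then show ?thesis
    using f by (simp add: inn_self)
qed

end

section \<open>Completeness, convergent series and coercive operators\<close>

locale hilbert = ip_space +
  assumes mcomplete: "M.mcomplete"
begin

text \<open>The Cauchy condition is asked only for ordered indices, which is how estimates for
  blocks of a series arise; symmetry of the norm supplies the other order.\<close>

lemma Cauchy_converges:
  assumes x: "\<And>n. x n \<in> V"
    and cauchy: "\<And>e. e > 0 \<Longrightarrow> \<exists>N. \<forall>m\<ge>N. \<forall>n\<ge>m. inn_norm X (x n - x m) < e"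
  obtains l where "l \<in> V" "converges_in X x l"
proof -
  have "M.MCauchy x"
    unfolding M.MCauchy_def
  proof (intro conjI allI impI)
    fix e :: real assume "e > 0"
    then obtain N where N: "\<And>m n. m \<ge> N \<Longrightarrow> n \<ge> m \<Longrightarrow> inn_norm X (x n - x m) < e"
      using cauchy by blast
    have "inn_dist X (x n) (x m) < e" if "N \<le> n" "N \<le> m" for n m
      using N[of n m] N[of m n] x that inn_norm_diff_commute[of "x n" "x m"] linear[of n m]
      by (auto simp: inn_dist_def)
    then show "\<exists>N. \<forall>n n'. N \<le> n \<longrightarrow> N \<le> n' \<longrightarrow> inn_dist X (x n) (x n') < e"
      by blast
  qed (use x in auto)
  then obtain l where "limitin M.mtopology x l sequentially"
    using mcomplete M.mcomplete_def by blast
  then show ?thesis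
    using that converges_in_V by (auto simp: converges_in_def inn_topology_def)
qed

text \<open>Tail sums are controlled through a real convergent series, which covers both absolutely
  convergent series and the expansions along a Bessel sequence.\<close>

lemma sums_in_if_tails_small:
  assumes x: "\<And>n. x n \<in> V" and a: "summable a"
    and tail: "\<And>m n. m \<le> n \<Longrightarrow> (inn_norm X (\<Sum>i=m..<n. x i)) ^ k \<le> C * (\<Sum>i=m..<n. a i)"
    and k: "k > 0"
  obtains s where "s \<in> V" "sums_in X x s"
proof -
  have "\<exists>N. \<forall>m\<ge>N. \<forall>n\<ge>m. inn_norm X ((\<Sum>i<n. x i) - (\<Sum>i<m. x i)) < e" if "e > 0" for e
  proof -
    \<comment> \<open>Dividing by \<open>\<bar>C\<bar> + 1\<close> keeps the threshold positive
      whatever the sign of \<open>C\<close>, including 0. The exponent is 1 for geometric domination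
      and 2 for Bessel estimates.\<close>
    have "e ^ k / (\<bar>C\<bar> + 1) > 0" using that by simp
    then obtain N where N: "\<And>m n. m \<ge> N \<Longrightarrow> norm (\<Sum>i=m..<n. a i) < e ^ k / (\<bar>C\<bar> + 1)"
      using a unfolding summable_Cauchy by blast
    have "inn_norm X ((\<Sum>i<n. x i) - (\<Sum>i<m. x i)) < e" if "m \<ge> N" "n \<ge> m" for m n
    proof -
      have "(inn_norm X (\<Sum>i=m..<n. x i)) ^ k \<le> \<bar>C\<bar> * \<bar>\<Sum>i=m..<n. a i\<bar>"
        using tail[OF that(2)] by (metis abs_ge_self abs_mult order_trans)
      also have "\<dots> \<le> (\<bar>C\<bar> + 1) * \<bar>\<Sum>i=m..<n. a i\<bar>"
        by (simp add: mult_right_mono)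
      also have "\<dots> < e ^ k"
        using N[OF that(1), of n] by (simp add: field_simps)
      finally have "inn_norm X (\<Sum>i=m..<n. x i) < e"
        using \<open>e > 0\<close> by (meson power_less_imp_less_base less_imp_le)
      moreover have "(\<Sum>i<n. x i) - (\<Sum>i<m. x i) = (\<Sum>i=m..<n. x i)"
        using that sum_diff_nat_ivl[of 0 m n x] by (simp add: lessThan_atLeast0)
      ultimately show ?thesis by simp
    qed
    then show ?thesis by blast
  qed
  then show ?thesis
    using Cauchy_converges[of "\<lambda>N. \<Sum>i<N. x i"] that x unfolding sums_in_def by blast
qed

text \<open>A Lax-Milgram argument by Neumann series: for a suitable step \<open>t\<close> the map
  \<open>R = I - t T\<close> is a strict contraction, so \<open>t\<close> times the sum of all
  \<open>R ^^ i\<close> applied to \<open>h\<close> is a preimage of \<open>h\<close>.\<close>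

lemma coercive_surj:
  assumes T: "\<And>f. f \<in> V \<Longrightarrow> T f \<in> V" "\<And>f g. f \<in> V \<Longrightarrow> g \<in> V \<Longrightarrow> T (f - g) = T f - T g"
      "\<And>c f. f \<in> V \<Longrightarrow> T (scl X c f) = scl X c (T f)"
    and bound: "\<And>f. f \<in> V \<Longrightarrow> inn_norm X (T f) \<le> C * inn_norm X f"
    and coercive: "\<And>f. f \<in> V \<Longrightarrow> A * (inn_norm X f)\<^sup>2 \<le> Re (inn X (T f) f)"
    and A: "0 < A" "A \<le> C" and h: "h \<in> V"
  obtains f where "f \<in> V" "T f = h"
proof -
  \<comment> \<open>This \<open>t\<close> minimises
    \<open>1 - 2 * t * A + t\<^sup>2 * C\<^sup>2\<close>, the bound for the squared norm of
    \<open>R\<close>; the minimum is \<open>q\<^sup>2\<close>. It is nonnegative since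
    \<open>A \<le> C\<close> and below 1 since \<open>A > 0\<close>.\<close>
  define t where "t = A / C\<^sup>2"
  define q where "q = sqrt (1 - A\<^sup>2 / C\<^sup>2)"
  have C: "C > 0" using A by simp
  have AC: "0 < A\<^sup>2 / C\<^sup>2" "A\<^sup>2 / C\<^sup>2 \<le> 1"
    using A by (auto simp: power_mono)
  then have q: "0 \<le> q" "q < 1" "q\<^sup>2 = 1 - A\<^sup>2 / C\<^sup>2"
    unfolding q_def by auto
  define R where "R f = f - scl X (of_real t) (T f)" for f
  have R_V: "R f \<in> V" if "f \<in> V" for f
    using that T by (auto simp: R_def)
  have R_norm: "inn_norm X (R f) \<le> q * inn_norm X f" if f: "f \<in> V" for f
  proof -
    have "(inn_norm X (T f))\<^sup>2 \<le> (C * inn_norm X f)\<^sup>2"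
      using f T(1) bound by (intro power_mono) auto
    then have "t\<^sup>2 * (inn_norm X (T f))\<^sup>2 \<le> t\<^sup>2 * (C * inn_norm X f)\<^sup>2"
      by (rule mult_left_mono) simp
    also have "\<dots> = A\<^sup>2 / C\<^sup>2 * (inn_norm X f)\<^sup>2"
      using C by (simp add: t_def power_divide power_mult_distrib power2_eq_square)
    finally have *: "t\<^sup>2 * (inn_norm X (T f))\<^sup>2 \<le> A\<^sup>2 / C\<^sup>2 * (inn_norm X f)\<^sup>2" .
    have Re: "Re (inn X f (T f)) = Re (inn X (T f) f)"
      using f T(1) inn_commute[of f "T f"] by simp
    have "t * (A * (inn_norm X f)\<^sup>2) \<le> t * Re (inn X (T f) f)"
      using coercive[OF f] A by (intro mult_left_mono) (auto simp: t_def)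
    then have **: "A\<^sup>2 / C\<^sup>2 * (inn_norm X f)\<^sup>2 \<le> t * Re (inn X (T f) f)"
      by (simp add: t_def power2_eq_square)
    have "(inn_norm X (R f))\<^sup>2 =
        (inn_norm X f)\<^sup>2 - 2 * (t * Re (inn X (T f) f)) + t\<^sup>2 * (inn_norm X (T f))\<^sup>2"
      using f T(1) Re
      by (simp add: R_def inn_norm_diff_sq inn_scale_right inn_norm_scale power_mult_distrib)
    also have "\<dots> \<le> (q * inn_norm X f)\<^sup>2"
      using * ** by (simp add: power_mult_distrib q(3) algebra_simps)
    finally show ?thesis
      using q f by (meson power2_le_imp_le mult_nonneg_nonneg inn_norm_nonneg)
  qed
  define r where "r n = (R ^^ n) h" for n
  have r_V: "r n \<in> V" for n
    by (induction n) (auto simp: r_def h R_V)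
  have r_norm: "inn_norm X (r n) \<le> q ^ n * inn_norm X h" for n
  proof (induction n)
    case (Suc n)
    have "inn_norm X (r (Suc n)) \<le> q * inn_norm X (r n)"
      using R_norm[OF r_V[of n]] by (simp add: r_def)
    also have "\<dots> \<le> q * (q ^ n * inn_norm X h)"
      using Suc q by (intro mult_left_mono)
    finally show ?case by simp
  qed (simp add: r_def)
  obtain s where s: "s \<in> V" "sums_in X r s"
  proof (rule sums_in_if_tails_small[of r "\<lambda>n. q ^ n" 1 "inn_norm X h"])
    show "inn_norm X (\<Sum>i=m..<n. r i) ^ 1 \<le> inn_norm X h * (\<Sum>i=m..<n. q ^ i)" for m n
      using inn_norm_sum[of "{m..<n}" r] sum_mono[of "{m..<n}", OF r_norm] r_V
      by (auto simp: sum_distrib_left mult.commute intro: order_trans)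
  qed (use r_V q in \<open>auto simp: summable_geometric\<close>)
  define x where "x n = scl X (of_real t) (\<Sum>i<n. r i)" for n
  have x_V: "x n \<in> V" for n
    using r_V by (auto simp: x_def)
  have x: "converges_in X x (scl X (of_real t) s)"
    using s r_V unfolding x_def sums_in_def by (intro converges_in_scale) auto
  have T_add: "T (f + g) = T f + T g" if "f \<in> V" "g \<in> V" for f g
    using T(2)[of "f + g" g] that by (simp add: diff_eq_eq)
  \<comment> \<open>The sum telescopes: \<open>t T (r i) = r i - r (i + 1)\<close> by the definition
    of \<open>R\<close>, and \<open>r 0 = h\<close>. The residual \<open>r n\<close> tends to 0
    geometrically.\<close>
  have Tx: "T (x n) = h - r n" for n
  proof (induction n)
    case 0
    show ?case using T(3)[of 0 0] by (simp add: x_def r_def)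
  next
    case (Suc n)
    have "x (Suc n) = x n + scl X (of_real t) (r n)"
      by (simp add: x_def scale_right_distrib)
    then have "T (x (Suc n)) = T (x n) + scl X (of_real t) (T (r n))"
      using x_V r_V by (simp add: T_add T(3))
    then show ?case
      using Suc by (simp add: r_def R_def)
  qed
  have "(\<lambda>n. q ^ n * inn_norm X h) \<longlonglongrightarrow> 0"
    using q by (intro tendsto_mult_left_zero LIMSEQ_power_zero) auto
  then have "(\<lambda>n. inn_norm X (r n - 0)) \<longlonglongrightarrow> 0"
    by (rule LIMSEQ_null_squeeze) (use r_V r_norm in auto)
  then have "converges_in X r 0"
    using r_V by (simp add: converges_in_iff)
  then have "converges_in X (\<lambda>n. T (x n)) (h - 0)"
    unfolding Tx using h r_V by (rule_tac converges_in_diff) simp_all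
  moreover have "converges_in X (\<lambda>n. T (x n)) (T (scl X (of_real t) s))"
    using converges_in_bounded_image[OF T(1,2) bound x_V x] by blast
  ultimately have "T (scl X (of_real t) s) = h"
    using converges_in_unique by fastforce
  then show ?thesis
    using that s by blast
qed

end

section \<open>Bounded inverses and their action on series\<close>

context ip_space
begin

text \<open>The lower bound does double duty: it makes the kernel trivial and bounds the inverse by
  \<open>1 / A\<close>.\<close>

lemma boundedly_invertibleI:
  assumes V: "\<And>f. f \<in> V \<Longrightarrow> T f \<in> V"
    and diff: "\<And>f g. f \<in> V \<Longrightarrow> g \<in> V \<Longrightarrow> T (f - g) = T f - T g"
    and scale: "\<And>c f. f \<in> V \<Longrightarrow> T (scl X c f) = scl X c (T f)"
    and surj: "\<And>h. h \<in> V \<Longrightarrow> \<exists>f\<in>V. T f = h"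
    and lower: "\<And>f. f \<in> V \<Longrightarrow> A * inn_norm X f \<le> inn_norm X (T f)" and A: "A > 0"
  shows "boundedly_invertible X T"
  unfolding boundedly_invertible_def
proof (intro conjI ballI allI)
  show "T (f + g) = T f + T g" if "f \<in> V" "g \<in> V" for f g
    using diff[of "f + g" g] that by (simp add: diff_eq_eq)
  have inj: "inj_on T V"
  proof (rule inj_onI)
    fix f g assume fg: "f \<in> V" "g \<in> V" "T f = T g"
    then have "A * inn_norm X (f - g) \<le> 0"
      using lower[of "f - g"] diff[of f g] by simp
    then have "inn_norm X (f - g) = 0"
      using A fg inn_norm_nonneg[of "f - g"] by (auto simp: mult_le_0_iff simp del: inn_norm_eq_0 inn_norm_nonneg)
    then show "f = g" using fg by simp
  qed
  then show bij: "bij_betw T V V"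
    using V surj by (auto simp: bij_betw_def)
  show "\<exists>C. \<forall>h\<in>V. inn_norm X (the_inv_into V T h) \<le> C * inn_norm X h"
  proof (intro exI ballI)
    fix h assume "h \<in> V"
    then obtain f where f: "f \<in> V" "T f = h" using surj by blast
    then have "the_inv_into V T h = f"
      using the_inv_into_f_f[OF inj f(1)] by simp
    then show "inn_norm X (the_inv_into V T h) \<le> 1 / A * inn_norm X h"
      using lower[of f] f A by (simp add: field_simps)
  qed
qed (use scale in auto)

lemma the_inv_into_linear:
  assumes T: "boundedly_invertible X T" and h: "h \<in> V"
  shows "the_inv_into V T h \<in> V"
    and "g \<in> V \<Longrightarrow> the_inv_into V T (g + h) = the_inv_into V T g + the_inv_into V T h"
    and "the_inv_into V T (scl X c h) = scl X c (the_inv_into V T h)"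
proof -
  have bij: "inj_on T V" "T ` V = V"
    and add: "\<And>f g. f \<in> V \<Longrightarrow> g \<in> V \<Longrightarrow> T (f + g) = T f + T g"
    and scale: "\<And>c f. f \<in> V \<Longrightarrow> T (scl X c f) = scl X c (T f)"
    using T by (auto simp: boundedly_invertible_def bij_betw_def)
  have inv: "the_inv_into V T h \<in> V \<and> T (the_inv_into V T h) = h" if "h \<in> V" for h
    using bij that f_the_inv_into_f[of T V h] the_inv_into_into[of T V h V] by auto
  show "the_inv_into V T h \<in> V"
    using inv h by blast
  show "the_inv_into V T (g + h) = the_inv_into V T g + the_inv_into V T h" if "g \<in> V"
    using bij(1) by (rule the_inv_into_f_eq) (use inv that h in \<open>auto simp: add\<close>)
  show "the_inv_into V T (scl X c h) = scl X c (the_inv_into V T h)"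
    using bij(1) by (rule the_inv_into_f_eq) (use inv h in \<open>auto simp: scale\<close>)
qed

text \<open>The inverse is linear, hence commutes with partial sums, and bounded, hence commutes
  with their limit.\<close>

lemma the_inv_into_sums_in:
  assumes T: "boundedly_invertible X T" and x: "\<And>n. x n \<in> V"
    and sums: "sums_in X x (T f)" and f: "f \<in> V"
  shows "sums_in X (\<lambda>n. the_inv_into V T (x n)) f"
proof -
  let ?R = "the_inv_into V T"
  obtain C where C: "\<And>h. h \<in> V \<Longrightarrow> inn_norm X (?R h) \<le> C * inn_norm X h"
    using T unfolding boundedly_invertible_def by blast
  note R = the_inv_into_linear[OF T]
  have diff: "?R (g - h) = ?R g - ?R h" if "g \<in> V" "h \<in> V" for g h
    using R(2)[of h "g - h"] that by (simp add: eq_diff_eq)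
  have "?R (\<Sum>n<N. x n) = (\<Sum>n<N. ?R (x n))" for N
  proof (induction N)
    case 0
    show ?case using diff[of 0 0] by simp
  next
    case (Suc N)
    then show ?case
      using R(2)[of "x N" "\<Sum>n<N. x n"] x by simp
  qed
  moreover have "converges_in X (\<lambda>N. ?R (\<Sum>n<N. x n)) (?R (T f))"
    using converges_in_bounded_image[OF R(1) diff C, of "\<lambda>N. \<Sum>n<N. x n" "T f"] x sums
    by (simp add: sums_in_def)
  moreover have "?R (T f) = f"
    using T f by (auto simp: boundedly_invertible_def bij_betw_def intro: the_inv_into_f_f)
  ultimately show ?thesis
    by (simp add: sums_in_def)
qed

end

section \<open>Frames\<close>

text \<open>It suffices to require the frame inequalities on a dense set.\<close>

locale hilbert_frame = hilbert +
  fixes g :: "nat \<Rightarrow> 'a" and E :: "'a set" and A B :: real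
  assumes g_V: "\<And>n. g n \<in> V"
    and E_V: "E \<subseteq> V" and E_dense: "inn_topology X closure_of E = V"
    and bounds_pos: "0 < A" "A \<le> B"
    and frame_summable: "\<And>f. f \<in> E \<Longrightarrow> summable (\<lambda>n. (cmod (inn X f (g n)))\<^sup>2)"
    and frame_lower: "\<And>f. f \<in> E \<Longrightarrow> A * (inn_norm X f)\<^sup>2 \<le> (\<Sum>n. (cmod (inn X f (g n)))\<^sup>2)"
    and frame_upper: "\<And>f. f \<in> E \<Longrightarrow> (\<Sum>n. (cmod (inn X f (g n)))\<^sup>2) \<le> B * (inn_norm X f)\<^sup>2"
begin

lemma dense_approx:
  assumes "f \<in> V"
  obtains x where "range x \<subseteq> E" "\<And>n. x n \<in> V" "converges_in X x f"
proof -
  obtain x where x: "range x \<subseteq> E" "converges_in X x f"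
    using assms in_closure_of_iff[OF E_V] E_dense by auto
  with that[of x] E_V show thesis by auto
qed

text \<open>For a fixed finite \<open>I\<close> both sides are continuous in \<open>f\<close>, so
  the upper inequality extends from \<open>E\<close> to the whole space without interchanging a
  limit with an infinite sum.\<close>

lemma bessel:
  assumes f: "f \<in> V" and I: "finite I"
  shows "(\<Sum>n\<in>I. (cmod (inn X f (g n)))\<^sup>2) \<le> B * (inn_norm X f)\<^sup>2"
proof -
  obtain x where x: "range x \<subseteq> E" "\<And>n. x n \<in> V" "converges_in X x f"
    using dense_approx[OF f] by blast
  have "(\<lambda>k. inn X (x k) (g n)) \<longlonglongrightarrow> inn X f (g n)" for n
    using x g_V by (intro converges_in_inn) auto
  then have "(\<lambda>k. \<Sum>n\<in>I. (cmod (inn X (x k) (g n)))\<^sup>2) \<longlonglongrightarrow> (\<Sum>n\<in>I. (cmod (inn X f (g n)))\<^sup>2)"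
    by (intro tendsto_intros)
  moreover have "(\<lambda>k. B * (inn_norm X (x k))\<^sup>2) \<longlonglongrightarrow> B * (inn_norm X f)\<^sup>2"
    using x by (intro tendsto_intros converges_in_norm)
  moreover have "(\<Sum>n\<in>I. (cmod (inn X (x k) (g n)))\<^sup>2) \<le> B * (inn_norm X (x k))\<^sup>2" for k
  proof -
    have "x k \<in> E" using x(1) by auto
    then show ?thesis
      using sum_le_suminf[OF frame_summable I] frame_upper by (force intro: order_trans)
  qed
  ultimately show ?thesis
    by (blast intro: LIMSEQ_le)
qed

lemma coeff_summable: "f \<in> V \<Longrightarrow> summable (\<lambda>n. (cmod (inn X f (g n)))\<^sup>2)"
  using bessel by (intro bounded_imp_summable) auto

text \<open>Synthesis is adjoint to taking coefficients, so it inherits the Bessel bound: pair the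
  combination \<open>h\<close> with itself, expand one factor, use Cauchy-Schwarz for finite sums
  and \<open>bessel\<close>, then cancel the squared norm of \<open>h\<close>.\<close>

lemma synthesis_bound:
  assumes I: "finite I"
  shows "(inn_norm X (\<Sum>n\<in>I. scl X (c n) (g n)))\<^sup>2 \<le> B * (\<Sum>n\<in>I. (cmod (c n))\<^sup>2)"
proof -
  define h where "h = (\<Sum>n\<in>I. scl X (c n) (g n))"
  have h: "h \<in> V" unfolding h_def using g_V by blast
  have "inn X h h = (\<Sum>n\<in>I. c n * cnj (inn X h (g n)))"
    using h g_V inn_commute[of h "g _"] unfolding h_def
    by (subst inn_sum_left) (auto simp: inn_scale_left)
  then have "(inn_norm X h)\<^sup>2 = cmod (\<Sum>n\<in>I. c n * cnj (inn X h (g n)))"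
    using h inn_self by (metis norm_of_real abs_power2)
  also have "\<dots> \<le> (\<Sum>n\<in>I. cmod (c n) * cmod (inn X h (g n)))"
    by (rule order_trans[OF norm_sum]) (simp add: norm_mult)
  finally have "((inn_norm X h)\<^sup>2)\<^sup>2 \<le> (\<Sum>n\<in>I. cmod (c n) * cmod (inn X h (g n)))\<^sup>2"
    by (intro power_mono) auto
  also have "\<dots> \<le> (\<Sum>n\<in>I. (cmod (c n))\<^sup>2) * (\<Sum>n\<in>I. (cmod (inn X h (g n)))\<^sup>2)"
    by (rule Cauchy_Schwarz_ineq_sum)
  also have "\<dots> \<le> (\<Sum>n\<in>I. (cmod (c n))\<^sup>2) * (B * (inn_norm X h)\<^sup>2)"
    using bessel[OF h I] by (intro mult_left_mono) (auto intro: sum_nonneg)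
  finally have *: "(inn_norm X h)\<^sup>2 * (inn_norm X h)\<^sup>2 \<le> B * (\<Sum>n\<in>I. (cmod (c n))\<^sup>2) * (inn_norm X h)\<^sup>2"
    by (simp add: power2_eq_square mult_ac)
  \<comment> \<open>Covers the case of norm 0, in which nothing can be cancelled.\<close>
  have "0 \<le> B * (\<Sum>n\<in>I. (cmod (c n))\<^sup>2)"
    using bounds_pos by (simp add: sum_nonneg)
  then have "(inn_norm X h)\<^sup>2 \<le> B * (\<Sum>n\<in>I. (cmod (c n))\<^sup>2)"
    using mult_right_le_imp_le[OF *] by (cases "inn_norm X h = 0") auto
  then show ?thesis unfolding h_def .
qed

section \<open>The frame operator of a Hilbert space frame\<close>

definition frame_op :: "'a \<Rightarrow> 'a" where
  "frame_op f = (THE h. sums_in X (\<lambda>n. scl X (inn X f (g n)) (g n)) h)"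

text \<open>Squared norms of blocks of the series are at most \<open>B\<close> times blocks of the
  summable series of squared coefficients, so the partial sums are Cauchy. With uniqueness of limits
  this justifies the \<open>THE\<close> in \<open>frame_op\<close>.\<close>

lemma frame_op_sums_in:
  assumes f: "f \<in> V"
  shows "sums_in X (\<lambda>n. scl X (inn X f (g n)) (g n)) (frame_op f)"
proof -
  obtain s where s: "sums_in X (\<lambda>n. scl X (inn X f (g n)) (g n)) s"
    by (rule sums_in_if_tails_small[of "\<lambda>n. scl X (inn X f (g n)) (g n)", OF _ coeff_summable[OF f] synthesis_bound])
      (auto simp: g_V)
  then show ?thesis
    unfolding frame_op_def
    by (rule theI2) (use s converges_in_unique in \<open>auto simp: sums_in_def\<close>)
qed

lemma frame_op_unique:
  "f \<in> V \<Longrightarrow> sums_in X (\<lambda>n. scl X (inn X f (g n)) (g n)) h \<Longrightarrow> frame_op f = h"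
  using frame_op_sums_in converges_in_unique unfolding sums_in_def by blast

lemma partial_V: "(\<Sum>n<N. scl X (c n) (g n)) \<in> V"
  using g_V by blast

lemma frame_op_V: "f \<in> V \<Longrightarrow> frame_op f \<in> V"
  using frame_op_sums_in converges_in_V unfolding sums_in_def by blast

lemma frame_op_diff:
  assumes f: "f \<in> V" and h: "h \<in> V"
  shows "frame_op (f - h) = frame_op f - frame_op h"
proof (rule frame_op_unique)
  have "converges_in X (\<lambda>N. (\<Sum>n<N. scl X (inn X f (g n)) (g n)) - (\<Sum>n<N. scl X (inn X h (g n)) (g n)))
      (frame_op f - frame_op h)"
    using frame_op_sums_in f h unfolding sums_in_def
    by (intro converges_in_diff partial_V) auto
  then show "sums_in X (\<lambda>n. scl X (inn X (f - h) (g n)) (g n)) (frame_op f - frame_op h)"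
    using f h g_V by (simp add: sums_in_def inn_diff_left scale_left_diff_distrib sum_subtractf)
qed (use f h in auto)

lemma frame_op_scale:
  assumes f: "f \<in> V"
  shows "frame_op (scl X c f) = scl X c (frame_op f)"
proof (rule frame_op_unique)
  have "converges_in X (\<lambda>N. scl X c (\<Sum>n<N. scl X (inn X f (g n)) (g n))) (scl X c (frame_op f))"
    using frame_op_sums_in f unfolding sums_in_def
    by (intro converges_in_scale partial_V) auto
  then show "sums_in X (\<lambda>n. scl X (inn X (scl X c f) (g n)) (g n)) (scl X c (frame_op f))"
    using f g_V by (simp add: sums_in_def inn_scale_left scale_sum_right)
qed (use f in auto)

text \<open>Taking coefficients and synthesis each contribute a factor sqrt \<open>B\<close>; the
  resulting bound on partial sums passes to the limit.\<close>

lemma frame_op_bound: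
  assumes f: "f \<in> V"
  shows "inn_norm X (frame_op f) \<le> B * inn_norm X f"
proof (rule LIMSEQ_le_const2)
  show "(\<lambda>N. inn_norm X (\<Sum>n<N. scl X (inn X f (g n)) (g n))) \<longlonglongrightarrow> inn_norm X (frame_op f)"
    using frame_op_sums_in[OF f] partial_V unfolding sums_in_def by (intro converges_in_norm)
  have "inn_norm X (\<Sum>n<N. scl X (inn X f (g n)) (g n)) \<le> B * inn_norm X f" for N
  proof (rule power2_le_imp_le)
    have "(inn_norm X (\<Sum>n<N. scl X (inn X f (g n)) (g n)))\<^sup>2 \<le> B * (\<Sum>n<N. (cmod (inn X f (g n)))\<^sup>2)"
      by (rule synthesis_bound) simp
    also have "\<dots> \<le> B * (B * (inn_norm X f)\<^sup>2)"
      using bounds_pos bessel[OF f] by (intro mult_left_mono) auto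
    finally show "(inn_norm X (\<Sum>n<N. scl X (inn X f (g n)) (g n)))\<^sup>2 \<le> (B * inn_norm X f)\<^sup>2"
      by (simp add: power2_eq_square mult_ac)
  qed (use bounds_pos f in simp)
  then show "\<exists>N. \<forall>n\<ge>N. inn_norm X (\<Sum>i<n. scl X (inn X f (g i)) (g i)) \<le> B * inn_norm X f"
    by blast
qed

text \<open>Identifies the sum in the frame inequalities with the quadratic form of the operator, so
  that the lower inequality becomes coercivity.\<close>

lemma inn_frame_op_sums:
  assumes f: "f \<in> V"
  shows "(\<lambda>n. (cmod (inn X f (g n)))\<^sup>2) sums Re (inn X (frame_op f) f)"
proof -
  have "(\<lambda>N. inn X (\<Sum>n<N. scl X (inn X f (g n)) (g n)) f) \<longlonglongrightarrow> inn X (frame_op f) f"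
    using frame_op_sums_in[OF f] partial_V f unfolding sums_in_def by (intro converges_in_inn) auto
  then have "(\<lambda>N. Re (inn X (\<Sum>n<N. scl X (inn X f (g n)) (g n)) f)) \<longlonglongrightarrow> Re (inn X (frame_op f) f)"
    by (rule tendsto_Re)
  moreover have "inn X (\<Sum>n<N. scl X (inn X f (g n)) (g n)) f = of_real (\<Sum>n<N. (cmod (inn X f (g n)))\<^sup>2)" for N
  proof -
    have "inn X (scl X (inn X f (g n)) (g n)) f = of_real ((cmod (inn X f (g n)))\<^sup>2)" for n
      using f g_V inn_commute[of f "g n"] unfolding complex_norm_square by (simp add: inn_scale_left)
    then show ?thesis
      using f g_V by (simp add: inn_sum_left)
  qed
  ultimately show ?thesis
    by (simp add: sums_def)
qed

text \<open>The lower inequality involves the full series, so finite truncations do not suffice.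
  Rewritten through the bounded operator, both sides are continuous, and the inequality extends from
  \<open>E\<close> by density.\<close>

lemma frame_op_coercive:
  assumes f: "f \<in> V"
  shows "A * (inn_norm X f)\<^sup>2 \<le> Re (inn X (frame_op f) f)"
proof -
  obtain x where x: "range x \<subseteq> E" "\<And>n. x n \<in> V" "converges_in X x f"
    using dense_approx[OF f] by blast
  have "converges_in X (\<lambda>n. frame_op (x n)) (frame_op f)"
    by (rule converges_in_bounded_image[OF frame_op_V frame_op_diff frame_op_bound x(2,3)])
  then have "(\<lambda>n. inn X (frame_op (x n)) (x n)) \<longlonglongrightarrow> inn X (frame_op f) f"
    using x frame_op_V by (intro converges_in_inn) auto
  then have "(\<lambda>n. Re (inn X (frame_op (x n)) (x n))) \<longlonglongrightarrow> Re (inn X (frame_op f) f)"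
    by (rule tendsto_Re)
  moreover have "(\<lambda>n. A * (inn_norm X (x n))\<^sup>2) \<longlonglongrightarrow> A * (inn_norm X f)\<^sup>2"
    using x by (intro tendsto_intros converges_in_norm)
  moreover have "A * (inn_norm X (x n))\<^sup>2 \<le> Re (inn X (frame_op (x n)) (x n))" for n
    using frame_lower[of "x n"] x sums_unique[OF inn_frame_op_sums[OF x(2)[of n]]] by auto
  ultimately show ?thesis
    by (blast intro: LIMSEQ_le)
qed

lemma frame_op_lower:
  assumes f: "f \<in> V"
  shows "A * inn_norm X f \<le> inn_norm X (frame_op f)"
proof -
  have "A * (inn_norm X f)\<^sup>2 \<le> cmod (inn X (frame_op f) f)"
    using frame_op_coercive[OF f] complex_Re_le_cmod order_trans by blast
  also have "\<dots> \<le> inn_norm X (frame_op f) * inn_norm X f"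
    using f frame_op_V by (intro Cauchy_Schwarz)
  finally have "A * inn_norm X f * inn_norm X f \<le> inn_norm X (frame_op f) * inn_norm X f"
    by (simp add: power2_eq_square)
  then show ?thesis
    using f frame_op_V[OF f] inn_norm_nonneg[OF f] by (cases "inn_norm X f = 0") (auto simp: mult_le_cancel_right)
qed

lemma frame_op_surj: "h \<in> V \<Longrightarrow> \<exists>f\<in>V. frame_op f = h"
  using coercive_surj[OF frame_op_V frame_op_diff frame_op_scale frame_op_bound frame_op_coercive
      bounds_pos, of h] by blast

end

section \<open>Krein spaces\<close>

context module
begin

text \<open>Two candidates differ by an element of \<open>A\<close> that also lies in
  \<open>B\<close>. This evaluates the \<open>THE\<close> in \<open>component\<close> for all direct
  sums below.\<close>

lemma component_eq:
  assumes "subspace A" "subspace B" "A \<inter> B = {0}" and a: "a \<in> A" and b: "b \<in> B"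
  shows "component A B (a + b) = a"
  unfolding component_def
proof (rule the_equality)
  fix u assume u: "u \<in> A \<and> a + b - u \<in> B"
  then have "a - u \<in> A" "(a + b - u) - b \<in> B"
    using assms subspace_diff by blast+
  then have "a - u \<in> A \<inter> B" by (simp add: algebra_simps)
  then show "u = a" using assms by simp
qed (use a b in simp)

end

section \<open>The Krein form and the associated Hilbert inner product\<close>

locale krein =
  fixes K :: "'a::ab_group_add krein"
  assumes krein_space: "krein_space K"
begin

sublocale vector_space "scal K"
  using krein_space unfolding krein_space_def by blast

lemma hermitian: "hermitian_form_on (scal K) UNIV (form K)"
  using krein_space unfolding krein_space_def by (elim conjE)

lemmas form_add_left = hermitian[unfolded hermitian_form_on_def, THEN conjunct1, rule_format, OF UNIV_I UNIV_I UNIV_I]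
  and form_scale_left = hermitian[unfolded hermitian_form_on_def, THEN conjunct2, THEN conjunct1, rule_format, OF UNIV_I UNIV_I]
  and form_commute = hermitian[unfolded hermitian_form_on_def, THEN conjunct2, THEN conjunct2, rule_format, OF UNIV_I UNIV_I]

lemma form_zero_left [simp]: "form K 0 h = 0"
  using form_add_left[of 0 0 h] by simp

lemma form_zero_right [simp]: "form K h 0 = 0"
  using form_commute[of h 0] by simp

lemma form_diff_left: "form K (f - g) h = form K f h - form K g h"
  using form_add_left[of "f - g" g h] by simp

lemma form_add_right: "form K h (f + g) = form K h f + form K h g"
  by (metis form_add_left form_commute complex_cnj_add)

lemma form_diff_right: "form K h (f - g) = form K h f - form K h g"
  using form_add_right[of h "f - g" g] by simp

lemma Im_form_self [simp]: "Im (form K f f) = 0"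
  using form_commute[of f f] by (metis cnj.simps(2) neg_equal_zero)

lemma pos_part:
  "subspace (pos_part K)" "\<And>f. f \<in> pos_part K \<Longrightarrow> f \<noteq> 0 \<Longrightarrow> 0 < Re (form K f f)"
  using krein_space by (auto simp: krein_space_def hilbert_space_def inner_product_space_def)

lemma neg_part:
  "subspace (neg_part K)" "\<And>f. f \<in> neg_part K \<Longrightarrow> f \<noteq> 0 \<Longrightarrow> Re (form K f f) < 0"
  using krein_space by (auto simp: krein_space_def hilbert_space_def inner_product_space_def)

lemma fund_orthogonal:
  assumes "u \<in> pos_part K" "v \<in> neg_part K"
  shows "form K u v = 0" "form K v u = 0"
proof -
  show "form K u v = 0"
    using assms krein_space unfolding krein_space_def by blast
  then show "form K v u = 0"
    using form_commute[of v u] by simp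
qed

lemma fund_decomp:
  obtains u v where "u \<in> pos_part K" "v \<in> neg_part K" "f = u + v"
proof -
  have "f \<in> {u + v | u v. u \<in> pos_part K \<and> v \<in> neg_part K}"
    using krein_space unfolding krein_space_def by blast
  then show thesis using that by blast
qed

lemma fund_symmetry_eq:
  assumes "u \<in> pos_part K" "v \<in> neg_part K"
  shows "fund_symmetry K (u + v) = u - v"
proof -
  have int: "pos_part K \<inter> neg_part K = {0}"
    using krein_space unfolding krein_space_def by blast
  have "component (pos_part K) (neg_part K) (u + v) = u"
    using pos_part(1) neg_part(1) int assms by (rule component_eq)
  moreover have "component (neg_part K) (pos_part K) (v + u) = v"
    using pos_part(1) neg_part(1) int assms by (intro component_eq) auto
  ultimately show ?thesis
    by (simp add: fund_symmetry_def add.commute)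
qed

lemma krein_hilbert_simps [simp]:
  "carr (krein_hilbert K) = UNIV" "scl (krein_hilbert K) = scal K"
  by (simp_all add: krein_hilbert_def)

lemma inn_krein_hilbert:
  assumes "u \<in> pos_part K" "v \<in> neg_part K" "u' \<in> pos_part K" "v' \<in> neg_part K"
  shows "inn (krein_hilbert K) (u + v) (u' + v') = form K u u' - form K v v'"
  using assms by (simp add: krein_hilbert_def fund_symmetry_eq form_diff_left form_add_right fund_orthogonal)

lemma inner_product_space_krein_hilbert: "inner_product_space (krein_hilbert K)"
  unfolding inner_product_space_def
proof (intro conjI)
  show "hermitian_form_on (scl (krein_hilbert K)) (carr (krein_hilbert K)) (inn (krein_hilbert K))"
    unfolding hermitian_form_on_def krein_hilbert_simps
  proof (intro conjI ballI allI)
    fix f g h :: 'a and c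
    obtain u v where f: "u \<in> pos_part K" "v \<in> neg_part K" "f = u + v" by (rule fund_decomp)
    obtain u' v' where g: "u' \<in> pos_part K" "v' \<in> neg_part K" "g = u' + v'" by (rule fund_decomp)
    obtain u'' v'' where h: "u'' \<in> pos_part K" "v'' \<in> neg_part K" "h = u'' + v''" by (rule fund_decomp)
    have "f + g = (u + u') + (v + v')" "u + u' \<in> pos_part K" "v + v' \<in> neg_part K"
      using f g pos_part(1) neg_part(1) by (auto simp: subspace_add algebra_simps)
    then show "inn (krein_hilbert K) (f + g) h = inn (krein_hilbert K) f h + inn (krein_hilbert K) g h"
      using f g h by (simp only: inn_krein_hilbert form_add_left) simp
    have "scal K c f = scal K c u + scal K c v" "scal K c u \<in> pos_part K" "scal K c v \<in> neg_part K"
      using f pos_part(1) neg_part(1) by (auto simp: subspace_scale scale_right_distrib)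
    then show "inn (krein_hilbert K) (scal K c f) g = c * inn (krein_hilbert K) f g"
      using f g by (simp only: inn_krein_hilbert form_scale_left) (simp add: algebra_simps)
    show "inn (krein_hilbert K) g f = cnj (inn (krein_hilbert K) f g)"
      using f g by (simp add: inn_krein_hilbert form_commute[of u' u] form_commute[of v' v])
  qed
  show "\<forall>f\<in>carr (krein_hilbert K). f \<noteq> 0 \<longrightarrow> 0 < Re (inn (krein_hilbert K) f f)"
  proof (intro ballI impI)
    fix f :: 'a assume "f \<noteq> 0"
    obtain u v where f: "u \<in> pos_part K" "v \<in> neg_part K" "f = u + v" by (rule fund_decomp)
    have "0 \<le> Re (form K u u)" "Re (form K v v) \<le> 0"
      using f pos_part(2)[of u] neg_part(2)[of v] by (cases "u = 0"; cases "v = 0"; force)+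
    moreover have "inn (krein_hilbert K) f f = form K u u - form K v v"
      using f by (simp add: inn_krein_hilbert)
    ultimately show "0 < Re (inn (krein_hilbert K) f f)"
      using f \<open>f \<noteq> 0\<close> pos_part(2)[of u] neg_part(2)[of v] by (cases "u = 0") force+
  qed
qed (simp_all add: vector_space_axioms)

sublocale KH: ip_space "krein_hilbert K"
  by standard (rule inner_product_space_krein_hilbert)

text \<open>The symmetry \<open>J\<close> is put on the second argument, so that continuity of the
  form in the first argument is read off from continuity of the inner product.\<close>

lemma form_eq_inn: "form K f g = inn (krein_hilbert K) f (fund_symmetry K g)"
proof -
  obtain u v where f: "u \<in> pos_part K" "v \<in> neg_part K" "f = u + v" by (rule fund_decomp)
  obtain u' v' where g: "u' \<in> pos_part K" "v' \<in> neg_part K" "g = u' + v'" by (rule fund_decomp)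
  \<comment> \<open>The vector \<open>u' - v'\<close> is written as a sum of one vector from each
    part to fit the component formula; \<open>0 - v'\<close> lets the difference rule extract the
    sign.\<close>
  have "inn (krein_hilbert K) (u + v) (u' + (- v')) = form K u u' - form K v (0 - v')"
    using f g neg_part(1) by (subst inn_krein_hilbert) (auto simp: subspace_neg)
  then show ?thesis
    using f g by (simp add: fund_symmetry_eq form_diff_right form_add_left form_add_right fund_orthogonal
        del: diff_0)
qed

text \<open>With a = [u,u] and b = -[v,v], both nonnegative, this is |a - b| \<le> a + b.\<close>

lemma abs_form_self_le: "\<bar>Re (form K f f)\<bar> \<le> (inn_norm (krein_hilbert K) f)\<^sup>2"
proof -
  obtain u v where f: "u \<in> pos_part K" "v \<in> neg_part K" "f = u + v" by (rule fund_decomp)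
  have "0 \<le> Re (form K u u)" "Re (form K v v) \<le> 0"
    using f pos_part(2)[of u] neg_part(2)[of v] by (cases "u = 0"; cases "v = 0"; force)+
  then show ?thesis
    using f by (simp add: KH.inn_norm_sq inn_krein_hilbert form_add_left form_add_right fund_orthogonal)
qed

lemma converges_in_form:
  assumes "converges_in (krein_hilbert K) w l"
  shows "(\<lambda>n. form K (w n) z) \<longlonglongrightarrow> form K l z"
  unfolding form_eq_inn using assms by (intro KH.converges_in_inn KH.converges_in_const) auto

end

section \<open>\<open>J\<close>-frames with \<open>J\<close>-orthogonal subspaces\<close>

text \<open>The bounds \<open>A\<close> and \<open>B\<close> are parameters shared by both sign
  classes, so that they can serve as the bounds of a single Hilbert space frame in
  \<open>H\<close>.\<close>

locale jframe_completion = krein K for K :: "'a::ab_group_add krein" +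
  fixes F :: "nat \<Rightarrow> 'a" and H :: "'b::ab_group_add inner_space" and \<iota> :: "'a \<Rightarrow> 'b"
    and A B :: real
  assumes positive: "positive_subspace K (M_plus K F)"
    and negative: "negative_subspace K (M_minus K F)"
    and orthogonal: "J_orthogonal K (M_plus K F) (M_minus K F)"
    and completion: "is_completion (D_space K F) H \<iota>"
    and bounds_pos: "0 < A" "A \<le> B"
    and bounds_plus: "frame_bounds K F (N_plus K F) A B"
    and bounds_minus: "frame_bounds K F (N_minus K F) A B"
begin

abbreviation Mp where "Mp \<equiv> M_plus K F"
abbreviation Mm where "Mm \<equiv> M_minus K F"
abbreviation D where "D \<equiv> D_sum K F"

sublocale DS: ip_space "D_space K F"
  using completion by unfold_locales (simp add: is_completion_def)

sublocale HS: hilbert H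
proof -
  have H: "hilbert_space H"
    using completion by (simp add: is_completion_def)
  then interpret H: ip_space H
    by unfold_locales (simp add: hilbert_space_def)
  show "hilbert H"
    using H by unfold_locales (simp add: hilbert_space_def)
qed

lemma carr_D_space [simp]: "carr (D_space K F) = D" and scl_D_space [simp]: "scl (D_space K F) = scal K"
  by (simp_all add: D_space_def Let_def)

lemma subspace_Mp: "subspace Mp" and subspace_Mm: "subspace Mm"
  using positive negative
  by (auto simp: positive_subspace_def negative_subspace_def closed_subspace_def)

lemma form_Mp_nonneg: "u \<in> Mp \<Longrightarrow> 0 \<le> Re (form K u u)"
  and form_Mm_nonpos: "v \<in> Mm \<Longrightarrow> Re (form K v v) \<le> 0"
  using positive negative
  by (cases "u = 0"; cases "v = 0"; force simp: positive_subspace_def negative_subspace_def)+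

lemma Mp_Int_Mm: "Mp \<inter> Mm = {0}"
proof -
  have "f = 0" if "f \<in> Mp" "f \<in> Mm" for f
    using that positive form_Mm_nonpos[of f] by (force simp: positive_subspace_def)
  then show ?thesis
    using subspace_0[OF subspace_Mp] subspace_0[OF subspace_Mm] by blast
qed

lemma form_Mp_Mm [simp]: "u \<in> Mp \<Longrightarrow> v \<in> Mm \<Longrightarrow> form K u v = 0"
  using orthogonal by (simp add: J_orthogonal_def)

lemma form_Mm_Mp [simp]: "u \<in> Mp \<Longrightarrow> v \<in> Mm \<Longrightarrow> form K v u = 0"
  using form_commute[of v u] by simp

lemma D_sumI [intro]: "u \<in> Mp \<Longrightarrow> v \<in> Mm \<Longrightarrow> u + v \<in> D"
  by (auto simp: D_sum_def)

lemma D_sumE: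
  assumes "f \<in> D"
  obtains u v where "u \<in> Mp" "v \<in> Mm" "f = u + v"
  using assms by (auto simp: D_sum_def)

lemma Mp_subset_D: "Mp \<subseteq> D" and Mm_subset_D: "Mm \<subseteq> D"
proof -
  show "Mp \<subseteq> D"
    using D_sumI[OF _ subspace_0[OF subspace_Mm]] by auto
  show "Mm \<subseteq> D"
    using D_sumI[OF subspace_0[OF subspace_Mp]] by auto
qed

lemma in_D [simp, intro]: "u \<in> Mp \<Longrightarrow> u \<in> D" "v \<in> Mm \<Longrightarrow> v \<in> D"
  using Mp_subset_D Mm_subset_D by auto

lemma D_diff: "f \<in> D \<Longrightarrow> g \<in> D \<Longrightarrow> f - g \<in> D"
  using DS.V_closed(3) by simp

lemma inn_D_space:
  assumes "u \<in> Mp" "v \<in> Mm" "u' \<in> Mp" "v' \<in> Mm"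
  shows "inn (D_space K F) (u + v) (u' + v') = form K u u' - form K v v'"
proof -
  have "component Mp Mm (a + b) = a \<and> component Mm Mp (a + b) = b" if "a \<in> Mp" "b \<in> Mm" for a b
    using component_eq[OF subspace_Mp subspace_Mm Mp_Int_Mm, of a b]
      component_eq[OF subspace_Mm subspace_Mp, of b a] Mp_Int_Mm that
    by (simp add: Int_commute add.commute)
  then show ?thesis
    using assms by (simp add: D_space_def Let_def)
qed

lemma emb_V [simp]: "f \<in> D \<Longrightarrow> \<iota> f \<in> carr H"
  and emb_add: "f \<in> D \<Longrightarrow> g \<in> D \<Longrightarrow> \<iota> (f + g) = \<iota> f + \<iota> g"
  and emb_scale: "f \<in> D \<Longrightarrow> \<iota> (scal K c f) = scl H c (\<iota> f)"
  and emb_inn: "f \<in> D \<Longrightarrow> g \<in> D \<Longrightarrow> inn H (\<iota> f) (\<iota> g) = inn (D_space K F) f g"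
  and emb_dense: "inn_topology H closure_of (\<iota> ` D) = carr H"
  using completion unfolding is_completion_def by auto

lemma emb_diff: "f \<in> D \<Longrightarrow> g \<in> D \<Longrightarrow> \<iota> (f - g) = \<iota> f - \<iota> g"
  using emb_add[of "f - g" g] D_diff[of f g] by simp

lemma emb_inn_eq:
  assumes "u \<in> Mp" "v \<in> Mm" "u' \<in> Mp" "v' \<in> Mm"
  shows "inn H (\<iota> (u + v)) (\<iota> (u' + v')) = form K u u' - form K v v'"
  using assms by (simp add: emb_inn D_sumI inn_D_space)

lemma emb_inn_Mp: "u \<in> Mp \<Longrightarrow> u' \<in> Mp \<Longrightarrow> inn H (\<iota> u) (\<iota> u') = form K u u'"
  using emb_inn_eq[of u 0 u' 0] subspace_0[OF subspace_Mm] by simp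

lemma emb_inn_Mm: "v \<in> Mm \<Longrightarrow> v' \<in> Mm \<Longrightarrow> inn H (\<iota> v) (\<iota> v') = - form K v v'"
  using emb_inn_eq[of 0 v 0 v'] subspace_0[OF subspace_Mp] by simp

lemma emb_inn_Mp_Mm: "u \<in> Mp \<Longrightarrow> v \<in> Mm \<Longrightarrow> inn H (\<iota> u) (\<iota> v) = 0"
  using emb_inn_eq[of u 0 0 v] subspace_0[OF subspace_Mp] subspace_0[OF subspace_Mm] by simp

lemma emb_norm: "f \<in> D \<Longrightarrow> inn_norm H (\<iota> f) = inn_norm (D_space K F) f"
  by (simp add: inn_norm_def emb_inn)

section \<open>The orthogonal decomposition of the completion\<close>

definition P where "P = closure_image H \<iota> Mp"
definition N where "N = closure_image H \<iota> Mm"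

lemma subspace_emb: "subspace M \<Longrightarrow> M \<subseteq> D \<Longrightarrow> HS.subspace (\<iota> ` M)"
proof (rule HS.subspaceI)
  assume M: "subspace M" "M \<subseteq> D"
  show "0 \<in> \<iota> ` M"
    using emb_diff[of 0 0] M subspace_0[OF M(1)] by (metis cancel_comm_monoid_add_class.diff_cancel image_iff subsetD)
  show "x + y \<in> \<iota> ` M" if "x \<in> \<iota> ` M" "y \<in> \<iota> ` M" for x y
    using that M emb_add subspace_add[OF M(1)] by (auto simp: subset_iff image_iff) metis
  show "scl H c x \<in> \<iota> ` M" if "x \<in> \<iota> ` M" for c x
    using that M emb_scale subspace_scale[OF M(1)] by (auto simp: subset_iff image_iff) metis
qed

lemma emb_image_V: "\<iota> ` Mp \<subseteq> carr H" "\<iota> ` Mm \<subseteq> carr H" "\<iota> ` D \<subseteq> carr H"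
  by auto

lemma subspace_P: "HS.subspace P" and subspace_N: "HS.subspace N"
  unfolding P_def N_def closure_image_def
  by (intro HS.subspace_closure_of subspace_emb subspace_Mp subspace_Mm Mp_subset_D Mm_subset_D emb_image_V)+

lemma P_V: "P \<subseteq> carr H" and N_V: "N \<subseteq> carr H"
  unfolding P_def N_def closure_image_def by (rule HS.closure_of_subset_V)+

lemma in_V [simp, intro]: "p \<in> P \<Longrightarrow> p \<in> carr H" "n \<in> N \<Longrightarrow> n \<in> carr H"
  using P_V N_V by auto

lemma emb_P [simp]: "u \<in> Mp \<Longrightarrow> \<iota> u \<in> P" and emb_N [simp]: "v \<in> Mm \<Longrightarrow> \<iota> v \<in> N"
  using HS.subset_closure_of[OF emb_image_V(1)] HS.subset_closure_of[OF emb_image_V(2)]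
  unfolding P_def N_def closure_image_def by blast+

lemma closure_image_approx:
  assumes "f \<in> closure_image H \<iota> M" "M \<subseteq> D"
  obtains x where "\<And>n. x n \<in> M" "converges_in H (\<lambda>n. \<iota> (x n)) f"
proof -
  have "\<iota> ` M \<subseteq> carr H" using assms by auto
  then obtain y where y: "range y \<subseteq> \<iota> ` M" "converges_in H y f"
    using assms HS.in_closure_of_iff unfolding closure_image_def by blast
  then have "\<forall>n. \<exists>u\<in>M. y n = \<iota> u" by auto
  then obtain x where "\<And>n. x n \<in> M" "\<And>n. y n = \<iota> (x n)" by metis
  moreover from this have "y = (\<lambda>n. \<iota> (x n))" by auto
  ultimately show thesis using that[of x] y by simp
qed

lemma closure_imageI:
  assumes "\<And>n. x n \<in> M" "M \<subseteq> D" "converges_in H (\<lambda>n. \<iota> (x n)) f"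
  shows "f \<in> closure_image H \<iota> M"
proof -
  have "\<iota> ` M \<subseteq> carr H" "range (\<lambda>n. \<iota> (x n)) \<subseteq> \<iota> ` M" using assms by auto
  then show ?thesis
    using assms(3) HS.in_closure_of_iff unfolding closure_image_def by blast
qed

text \<open>\<open>J\<close>-orthogonality makes the images of \<open>Mp\<close> and
  \<open>Mm\<close> orthogonal in \<open>H\<close>; continuity of the inner product carries this to
  the closures.\<close>

lemma P_orth_N:
  assumes p: "p \<in> P" and n: "n \<in> N"
  shows "inn H p n = 0" "inn H n p = 0"
proof -
  obtain x where x: "\<And>k. x k \<in> Mp" "converges_in H (\<lambda>k. \<iota> (x k)) p"
    using closure_image_approx[OF p[unfolded P_def] Mp_subset_D] by blast
  obtain y where y: "\<And>k. y k \<in> Mm" "converges_in H (\<lambda>k. \<iota> (y k)) n"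
    using closure_image_approx[OF n[unfolded N_def] Mm_subset_D] by blast
  have "(\<lambda>k. inn H (\<iota> (x k)) (\<iota> (y k))) \<longlonglongrightarrow> inn H p n"
    using x y by (intro HS.converges_in_inn) auto
  then show "inn H p n = 0"
    using x(1) y(1) by (simp add: emb_inn_Mp_Mm LIMSEQ_const_iff)
  then show "inn H n p = 0"
    using p n HS.inn_commute[of p n] by simp
qed

lemma P_Int_N: "P \<inter> N = {0}"
proof -
  have "f = 0" if "f \<in> P" "f \<in> N" for f
    using that P_orth_N(1)[of f f] HS.inn_pos[of f] by force
  then show ?thesis
    using HS.subspace_0[OF subspace_P] HS.subspace_0[OF subspace_N] by blast
qed

lemma inn_norm_P_N:
  assumes "p \<in> P" "n \<in> N"
  shows "(inn_norm H (p + n))\<^sup>2 = (inn_norm H p)\<^sup>2 + (inn_norm H n)\<^sup>2"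
  using assms by (simp add: HS.inn_norm_sq HS.inn_add_left HS.inn_add_right P_orth_N)

text \<open>Serves to pass from a convergent sequence to its components, whose increments are
  dominated by those of the sequence.\<close>

lemma Cauchy_norm_le:
  assumes x: "converges_in H x l" "\<And>k. x k \<in> carr H" "\<And>k. y k \<in> carr H"
    and le: "\<And>m n. inn_norm H (y n - y m) \<le> inn_norm H (x n - x m)"
  obtains l' where "l' \<in> carr H" "converges_in H y l'"
proof (rule HS.Cauchy_converges[of y])
  fix e :: real assume e: "e > 0"
  have l: "l \<in> carr H" "(\<lambda>k. inn_norm H (x k - l)) \<longlonglongrightarrow> 0"
    using x by (auto simp: HS.converges_in_iff)
  then have "\<forall>\<^sub>F k in sequentially. inn_norm H (x k - l) < e / 2"
    using e by (intro order_tendstoD) auto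
  then obtain k where k: "\<And>n. n \<ge> k \<Longrightarrow> inn_norm H (x n - l) < e / 2"
    unfolding eventually_sequentially by blast
  have "inn_norm H (y n - y m) < e" if "m \<ge> k" "n \<ge> m" for m n
    using le[of n m] HS.inn_norm_diff_triangle[of "x n" l "x m"] x(2) l(1) k[of m] k[of n] that
      HS.inn_norm_diff_commute[of l "x m"] by force
  then show "\<exists>k. \<forall>m\<ge>k. \<forall>n\<ge>m. inn_norm H (y n - y m) < e" by blast
qed (use that x in auto)

text \<open>Approximate \<open>h\<close> from \<open>D\<close> and split each approximant along
  \<open>Mp\<close> and \<open>Mm\<close>. By Pythagoras the positive components are Cauchy, so they
  converge to a point of \<open>P\<close>.\<close>

lemma P_N_decomp:
  assumes h: "h \<in> carr H"
  obtains p n where "p \<in> P" "n \<in> N" "h = p + n"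
proof -
  obtain x where x: "\<And>k. x k \<in> D" "converges_in H (\<lambda>k. \<iota> (x k)) h"
    using closure_image_approx[of h D] h emb_dense unfolding closure_image_def by auto
  have "\<forall>k. \<exists>u v. u \<in> Mp \<and> v \<in> Mm \<and> x k = u + v"
    using x(1) by (meson D_sumE)
  then obtain u v where uv: "\<And>k. u k \<in> Mp" "\<And>k. v k \<in> Mm" "\<And>k. x k = u k + v k"
    by metis
  have le: "inn_norm H (\<iota> (u k) - \<iota> (u m)) \<le> inn_norm H (\<iota> (x k) - \<iota> (x m))" for k m
  proof (rule power2_le_imp_le)
    have "\<iota> (x k) - \<iota> (x m) = (\<iota> (u k) - \<iota> (u m)) + (\<iota> (v k) - \<iota> (v m))"
      using uv by (simp add: emb_add)
    moreover have "\<iota> (u k) - \<iota> (u m) \<in> P" "\<iota> (v k) - \<iota> (v m) \<in> N"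
      using uv subspace_P subspace_N by (auto intro!: HS.subspace_diff)
    ultimately show "(inn_norm H (\<iota> (u k) - \<iota> (u m)))\<^sup>2 \<le> (inn_norm H (\<iota> (x k) - \<iota> (x m)))\<^sup>2"
      using inn_norm_P_N by simp
  qed (use x in auto)
  obtain p where p: "p \<in> carr H" "converges_in H (\<lambda>k. \<iota> (u k)) p"
    by (rule Cauchy_norm_le[OF x(2) _ _ le]) (use x(1) uv in auto)
  \<comment> \<open>The negative components need no Cauchy argument of their own: they are
    differences of two convergent sequences.\<close>
  have "converges_in H (\<lambda>k. \<iota> (x k) - \<iota> (u k)) (h - p)"
    using x uv p by (intro HS.converges_in_diff) auto
  then have n: "converges_in H (\<lambda>k. \<iota> (v k)) (h - p)"
    using uv by (simp add: emb_add)
  have "p \<in> P" "h - p \<in> N"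
    unfolding P_def N_def
    using closure_imageI[OF uv(1) Mp_subset_D p(2)] closure_imageI[OF uv(2) Mm_subset_D n] by auto
  then show thesis
    using that[of p "h - p"] by simp
qed

lemma component_P_N:
  assumes "p \<in> P" "n \<in> N"
  shows "component P N (p + n) = p" "component N P (p + n) = n"
  using HS.component_eq[OF subspace_P subspace_N P_Int_N, of p n] assms P_Int_N
    HS.component_eq[OF subspace_N subspace_P, of n p] by (simp_all add: Int_commute add.commute)

section \<open>The fundamental symmetry of the completion and the extended form\<close>

definition J1 where "J1 h = component P N h - component N P h"

lemma J1_eq: "p \<in> P \<Longrightarrow> n \<in> N \<Longrightarrow> J1 (p + n) = p - n"
  by (simp add: J1_def component_P_N)

lemma J1_V: "h \<in> carr H \<Longrightarrow> J1 h \<in> carr H"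
  by (rule P_N_decomp[of h]) (auto simp: J1_eq)

lemma J1_diff:
  assumes f: "f \<in> carr H" and g: "g \<in> carr H"
  shows "J1 (f - g) = J1 f - J1 g"
proof -
  obtain p n where f: "p \<in> P" "n \<in> N" "f = p + n" using P_N_decomp[OF f] .
  obtain p' n' where g: "p' \<in> P" "n' \<in> N" "g = p' + n'" using P_N_decomp[OF g] .
  have "J1 ((p - p') + (n - n')) = (p - p') - (n - n')"
    using f g subspace_P subspace_N by (intro J1_eq) (auto intro: HS.subspace_diff)
  moreover have "f - g = (p - p') + (n - n')" using f g by simp
  ultimately have "J1 (f - g) = (p - p') - (n - n')" by metis
  also have "\<dots> = J1 f - J1 g" using f g by (simp add: J1_eq)
  finally show ?thesis .
qed

lemma J1_scale:
  assumes f: "f \<in> carr H"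
  shows "J1 (scl H c f) = scl H c (J1 f)"
proof -
  obtain p n where f: "p \<in> P" "n \<in> N" "f = p + n" using P_N_decomp[OF f] .
  have "J1 (scl H c p + scl H c n) = scl H c p - scl H c n"
    using f subspace_P subspace_N by (intro J1_eq) (auto intro: HS.subspace_scale)
  then show ?thesis
    using f by (simp add: J1_eq HS.scale_right_distrib HS.scale_right_diff_distrib)
qed

lemma J1_J1: "f \<in> carr H \<Longrightarrow> J1 (J1 f) = f"
proof -
  assume f: "f \<in> carr H"
  obtain p n where f: "p \<in> P" "n \<in> N" "f = p + n" using P_N_decomp[OF f] .
  have "J1 (p + (- n)) = p - (- n)"
    using f subspace_N by (intro J1_eq) (auto intro: HS.subspace_neg)
  then show ?thesis using f by (simp add: J1_eq)
qed

lemma J1_norm: "f \<in> carr H \<Longrightarrow> inn_norm H (J1 f) = inn_norm H f"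
proof -
  assume f: "f \<in> carr H"
  obtain p n where f: "p \<in> P" "n \<in> N" "f = p + n" using P_N_decomp[OF f] .
  then have "inn H (J1 f) (J1 f) = inn H f f"
    by (simp add: J1_eq HS.inn_diff_left HS.inn_diff_right HS.inn_add_left HS.inn_add_right P_orth_N)
  then show ?thesis by (simp add: inn_norm_def)
qed

text \<open>The factor \<open>c\<close> is the sign relating form and inner product: 1 on
  \<open>Mp\<close>, -1 on \<open>Mm\<close>. Continuity gives the value of the limit, and the
  existence of approximating sequences excludes any other value in the \<open>THE\<close>.\<close>

lemma ext_form_eq:
  assumes M: "M \<subseteq> D" and f: "f \<in> closure_image H \<iota> M" and g: "g \<in> closure_image H \<iota> M"
    and form: "\<And>x y. x \<in> M \<Longrightarrow> y \<in> M \<Longrightarrow> form K x y = c * inn H (\<iota> x) (\<iota> y)"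
  shows "ext_form K H \<iota> M f g = c * inn H f g"
proof -
  have lim: "(\<lambda>n. form K (x n) (y n)) \<longlonglongrightarrow> c * inn H f g"
    if "range x \<subseteq> M" "range y \<subseteq> M" "converges_in H (\<lambda>n. \<iota> (x n)) f" "converges_in H (\<lambda>n. \<iota> (y n)) g" for x y
  proof -
    have xy: "x n \<in> M" "y n \<in> M" "x n \<in> D" "y n \<in> D" for n using that M by auto
    have "(\<lambda>n. c * inn H (\<iota> (x n)) (\<iota> (y n))) \<longlonglongrightarrow> c * inn H f g"
      using that xy by (intro tendsto_mult_left HS.converges_in_inn) auto
    then show ?thesis using form xy by simp
  qed
  obtain x where x: "\<And>n. x n \<in> M" "converges_in H (\<lambda>n. \<iota> (x n)) f"
    using closure_image_approx[OF f M] by blast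
  obtain y where y: "\<And>n. y n \<in> M" "converges_in H (\<lambda>n. \<iota> (y n)) g"
    using closure_image_approx[OF g M] by blast
  show ?thesis
    unfolding ext_form_def
  proof (rule the_equality)
    fix d assume "\<forall>x y. range x \<subseteq> M \<and> range y \<subseteq> M \<and> converges_in H (\<lambda>n. \<iota> (x n)) f \<and>
        converges_in H (\<lambda>n. \<iota> (y n)) g \<longrightarrow> (\<lambda>n. form K (x n) (y n)) \<longlonglongrightarrow> d"
    then have "(\<lambda>n. form K (x n) (y n)) \<longlonglongrightarrow> d"
      using x y by blast
    moreover have "(\<lambda>n. form K (x n) (y n)) \<longlonglongrightarrow> c * inn H f g"
      using lim[of x y] x y by blast
    ultimately show "d = c * inn H f g"
      by (rule LIMSEQ_unique)
  qed (use lim in blast)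
qed

lemma form1_eq:
  assumes f: "f \<in> carr H" and g: "g \<in> carr H"
  shows "form1 K F H \<iota> f g = inn H (J1 f) g"
proof -
  obtain p n where f: "p \<in> P" "n \<in> N" "f = p + n" using P_N_decomp[OF f] .
  obtain p' n' where g: "p' \<in> P" "n' \<in> N" "g = p' + n'" using P_N_decomp[OF g] .
  have "form1 K F H \<iota> f g = ext_form K H \<iota> Mp p p' + ext_form K H \<iota> Mm n n'"
    using f g by (simp add: form1_def Let_def component_P_N flip: P_def N_def)
  also have "\<dots> = 1 * inn H p p' + (- 1) * inn H n n'"
    using f g emb_inn_Mp emb_inn_Mm Mp_subset_D Mm_subset_D unfolding P_def N_def
    by (intro arg_cong2[where f = "(+)"] ext_form_eq) auto
  also have "\<dots> = inn H (J1 f) g"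
    using f g by (simp add: J1_eq HS.inn_diff_left HS.inn_add_right P_orth_N)
  finally show ?thesis .
qed

text \<open>\<open>J1\<close> flips the sign of the \<open>Mm\<close> component, and the inner
  product of \<open>H\<close> flips it back; mixed terms vanish by \<open>J\<close>-orthogonality.
  Thus the extended form restricts to the Krein form on \<open>D\<close>.\<close>

lemma inn_J1_emb:
  assumes "x \<in> D" "z \<in> D"
  shows "inn H (J1 (\<iota> x)) (\<iota> z) = form K x z"
proof -
  obtain u v where x: "u \<in> Mp" "v \<in> Mm" "x = u + v" using D_sumE[OF assms(1)] .
  obtain u' v' where z: "u' \<in> Mp" "v' \<in> Mm" "z = u' + v'" using D_sumE[OF assms(2)] .
  have "J1 (\<iota> x) = \<iota> u - \<iota> v"
    using x by (simp add: emb_add J1_eq)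
  also have "\<dots> = \<iota> (u + (- v))"
    using x by (simp add: emb_diff)
  finally show ?thesis
    using x z subspace_neg[OF subspace_Mm, of v] form_diff_left[of 0 v v']
    by (simp add: emb_inn_eq form_add_left form_add_right del: diff_0 add_uminus_conv_diff) simp
qed

section \<open>The embedded vectors form a Hilbert space frame\<close>

definition g where "g n = \<iota> (F n)"
text \<open>The \<open>J\<close>-frame inequalities are given on the two spans only, so the dense
  set for the frame inequalities in \<open>H\<close> is built from these spans rather than from
  \<open>D\<close>.\<close>

definition E where "E = {\<iota> (u + v) | u v. u \<in> span (F ` N_plus K F) \<and> v \<in> span (F ` N_minus K F)}"

lemma span_plus_Mp: "span (F ` N_plus K F) \<subseteq> Mp" and span_minus_Mm: "span (F ` N_minus K F) \<subseteq> Mm"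
  unfolding M_plus_def M_minus_def by (rule KH.subset_closure_of, simp)+

lemma N_cases: "n \<in> N_plus K F \<or> n \<in> N_minus K F" "\<not> (n \<in> N_plus K F \<and> n \<in> N_minus K F)"
  by (auto simp: N_plus_def N_minus_def)

lemma F_in: "n \<in> N_plus K F \<Longrightarrow> F n \<in> Mp" "n \<in> N_minus K F \<Longrightarrow> F n \<in> Mm"
  using span_plus_Mp span_minus_Mm span_base by blast+

lemma F_D [simp]: "F n \<in> D"
  using N_cases(1)[of n] F_in by auto

lemma g_V [simp]: "g n \<in> carr H"
  by (simp add: g_def)

lemma E_V: "E \<subseteq> carr H"
proof
  fix f assume "f \<in> E"
  then obtain u v where "u \<in> Mp" "v \<in> Mm" "f = \<iota> (u + v)"
    using span_plus_Mp span_minus_Mm unfolding E_def by blast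
  then show "f \<in> carr H" by (simp add: D_sumI)
qed

text \<open>On \<open>M\<^sub>\<plusminus>\<close> the norm of \<open>H\<close> is dominated by that of the Krein space, hence approximation of
  elements of \<open>M\<^sub>\<plusminus>\<close> by finite combinations carries over to \<open>H\<close>.\<close>

lemma emb_norm_le:
  assumes "f \<in> Mp \<or> f \<in> Mm"
  shows "inn_norm H (\<iota> f) \<le> inn_norm (krein_hilbert K) f"
proof (rule power2_le_imp_le)
  have "f \<in> D" using assms by auto
  then have "(inn_norm H (\<iota> f))\<^sup>2 = \<bar>Re (form K f f)\<bar>"
    using assms form_Mp_nonneg[of f] form_Mm_nonpos[of f]
    by (auto simp: HS.inn_norm_sq emb_inn_Mp emb_inn_Mm)
  then show "(inn_norm H (\<iota> f))\<^sup>2 \<le> (inn_norm (krein_hilbert K) f)\<^sup>2"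
    using abs_form_self_le[of f] by simp
qed simp

text \<open>\<open>M\<close> is a subspace inside one of \<open>Mp\<close> and \<open>Mm\<close>, so
  the differences \<open>x n - l\<close> stay where the norm of \<open>H\<close> is
  dominated.\<close>

lemma converges_in_emb:
  assumes "subspace M" "M \<subseteq> Mp \<or> M \<subseteq> Mm" "\<And>n. x n \<in> M" "l \<in> M"
    and "converges_in (krein_hilbert K) x l"
  shows "converges_in H (\<lambda>n. \<iota> (x n)) (\<iota> l)"
proof -
  have D: "f \<in> D" if "f \<in> M" for f
    using that assms(2) by auto
  have "(\<lambda>n. inn_norm (krein_hilbert K) (x n - l)) \<longlonglongrightarrow> 0"
    using assms by (simp add: KH.converges_in_iff)
  then have "(\<lambda>n. inn_norm H (\<iota> (x n - l))) \<longlonglongrightarrow> 0"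
  proof (rule LIMSEQ_null_squeeze)
    fix n
    have "x n - l \<in> M"
      using assms by (simp add: subspace_diff)
    then show "0 \<le> inn_norm H (\<iota> (x n - l))"
      "inn_norm H (\<iota> (x n - l)) \<le> inn_norm (krein_hilbert K) (x n - l)"
      using assms(2) D emb_norm_le by auto
  qed
  then show ?thesis
    using D assms(3,4) by (simp add: HS.converges_in_iff emb_diff)
qed

text \<open>Each component is approximated within its own span in the Krein space norm, the
  approximation is carried to \<open>H\<close> separately for each sign, and the two limits are
  added there.\<close>

lemma emb_D_subset: "\<iota> ` D \<subseteq> inn_topology H closure_of E"
proof
  fix h assume "h \<in> \<iota> ` D"
  then obtain u v where uv: "u \<in> Mp" "v \<in> Mm" "h = \<iota> (u + v)"
    by (auto elim: D_sumE)
  obtain x where x: "range x \<subseteq> span (F ` N_plus K F)" "converges_in (krein_hilbert K) x u"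
    using uv(1) KH.in_closure_of_iff[of "span (F ` N_plus K F)" u] by (auto simp: M_plus_def)
  obtain y where y: "range y \<subseteq> span (F ` N_minus K F)" "converges_in (krein_hilbert K) y v"
    using uv(2) KH.in_closure_of_iff[of "span (F ` N_minus K F)" v] by (auto simp: M_minus_def)
  have xM: "x n \<in> Mp" "y n \<in> Mm" for n
    using x(1) y(1) span_plus_Mp span_minus_Mm by blast+
  have "converges_in H (\<lambda>n. \<iota> (x n)) (\<iota> u)" "converges_in H (\<lambda>n. \<iota> (y n)) (\<iota> v)"
    using converges_in_emb[OF subspace_Mp _ xM(1) uv(1) x(2)]
      converges_in_emb[OF subspace_Mm _ xM(2) uv(2) y(2)] by simp_all
  then have "converges_in H (\<lambda>n. \<iota> (x n) + \<iota> (y n)) (\<iota> u + \<iota> v)"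
    using xM by (intro HS.converges_in_add) auto
  then have "converges_in H (\<lambda>n. \<iota> (x n + y n)) h"
    using xM uv by (simp add: emb_add)
  moreover have "range (\<lambda>n. \<iota> (x n + y n)) \<subseteq> E"
    using x(1) y(1) unfolding E_def by blast
  ultimately show "h \<in> inn_topology H closure_of E"
    unfolding HS.in_closure_of_iff[OF E_V] by blast
qed

lemma E_dense: "inn_topology H closure_of E = carr H"
proof
  have "inn_topology H closure_of (\<iota> ` D) \<subseteq> inn_topology H closure_of (inn_topology H closure_of E)"
    by (rule closure_of_mono[OF emb_D_subset])
  then show "carr H \<subseteq> inn_topology H closure_of E"
    by (simp add: emb_dense)
qed (rule HS.closure_of_subset_V)

text \<open>For \<open>f = \<iota> (u + v)\<close> the coefficients with index in
  \<open>N_plus K F\<close> see only \<open>u\<close>, the others only \<open>v\<close> up to sign.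
  The two inequalities therefore add, and |[u,u]| + |[v,v]| is exactly the squared norm of
  \<open>f\<close> in \<open>H\<close>.\<close>

lemma frame_sums:
  assumes "f \<in> E"
  obtains s where "(\<lambda>n. (cmod (inn H f (g n)))\<^sup>2) sums s"
    and "A * (inn_norm H f)\<^sup>2 \<le> s" "s \<le> B * (inn_norm H f)\<^sup>2"
proof -
  obtain u v where uv: "u \<in> span (F ` N_plus K F)" "v \<in> span (F ` N_minus K F)" "f = \<iota> (u + v)"
    using assms by (auto simp: E_def)
  then have M: "u \<in> Mp" "v \<in> Mm"
    using span_plus_Mp span_minus_Mm by auto
  let ?c = "\<lambda>n. (cmod (inn H f (g n)))\<^sup>2"
  have cp: "?c n = (cmod (form K u (F n)))\<^sup>2" if "n \<in> N_plus K F" for n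
    using emb_inn_eq[of u v "F n" 0] M F_in(1)[OF that] subspace_0[OF subspace_Mm] uv(3) by (simp add: g_def)
  have cm: "?c n = (cmod (form K v (F n)))\<^sup>2" if "n \<in> N_minus K F" for n
    using emb_inn_eq[of u v 0 "F n"] M F_in(2)[OF that] subspace_0[OF subspace_Mp] uv(3) by (simp add: g_def)
  define a where "a = (\<Sum>\<^sub>\<infinity>n\<in>N_plus K F. (cmod (form K u (F n)))\<^sup>2)"
  define b where "b = (\<Sum>\<^sub>\<infinity>n\<in>N_minus K F. (cmod (form K v (F n)))\<^sup>2)"
  have "((\<lambda>n. (cmod (form K u (F n)))\<^sup>2) has_sum a) (N_plus K F)"
    and a: "A * cmod (form K u u) \<le> a" "a \<le> B * cmod (form K u u)"
    using bounds_plus uv(1) unfolding frame_bounds_def a_def by auto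
  then have "(?c has_sum a) (N_plus K F)"
    by (subst has_sum_cong[OF cp])
  moreover have "((\<lambda>n. (cmod (form K v (F n)))\<^sup>2) has_sum b) (N_minus K F)"
    and b: "A * cmod (form K v v) \<le> b" "b \<le> B * cmod (form K v v)"
    using bounds_minus uv(2) unfolding frame_bounds_def b_def by auto
  then have "(?c has_sum b) (N_minus K F)"
    by (subst has_sum_cong[OF cm])
  ultimately have "(?c has_sum (a + b)) (N_plus K F \<union> N_minus K F)"
    using N_cases(2) by (intro has_sum_Un_disjoint) auto
  moreover have "N_plus K F \<union> N_minus K F = UNIV"
    using N_cases(1) by auto
  \<comment> \<open>Unordered sums over the two index sets combine freely; the ordered series over
    all indices has the same sum.\<close>
  ultimately have "?c sums (a + b)"
    using has_sum_imp_sums by simp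
  moreover have "(inn_norm H f)\<^sup>2 = cmod (form K u u) + cmod (form K v v)"
    using M form_Mp_nonneg[OF M(1)] form_Mm_nonpos[OF M(2)]
    by (simp add: uv(3) HS.inn_norm_sq D_sumI emb_inn_eq cmod_eq_Re)
  ultimately show thesis
    using that a b by (simp add: distrib_left)
qed

sublocale fr: hilbert_frame H g E A B
proof
  fix f assume "f \<in> E"
  then obtain s where s: "(\<lambda>n. (cmod (inn H f (g n)))\<^sup>2) sums s"
    "A * (inn_norm H f)\<^sup>2 \<le> s" "s \<le> B * (inn_norm H f)\<^sup>2"
    by (rule frame_sums)
  then show "summable (\<lambda>n. (cmod (inn H f (g n)))\<^sup>2)"
    "A * (inn_norm H f)\<^sup>2 \<le> (\<Sum>n. (cmod (inn H f (g n)))\<^sup>2)"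
    "(\<Sum>n. (cmod (inn H f (g n)))\<^sup>2) \<le> B * (inn_norm H f)\<^sup>2"
    by (auto simp: sums_iff)
qed (use E_V E_dense bounds_pos in auto)

section \<open>The operator \<open>S\<close> and its bounded inverse\<close>

abbreviation S where "S \<equiv> frame_operator K F H \<iota>"

lemma frame_operator_eq: "f \<in> carr H \<Longrightarrow> S f = fr.frame_op (J1 f)"
  by (simp add: frame_operator_def fr.frame_op_def form1_eq flip: g_def)

lemma frame_operator_sums_in:
  assumes "f \<in> carr H"
  shows "sums_in H (\<lambda>n. scl H (form1 K F H \<iota> f (\<iota> (F n))) (\<iota> (F n))) (S f)"
  using fr.frame_op_sums_in[OF J1_V[OF assms]] assms by (simp add: frame_operator_eq form1_eq flip: g_def)

text \<open>\<open>J1\<close> is a linear isometric involution, so composing the ordinary frame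
  operator with it preserves surjectivity and the lower bound \<open>A\<close>.\<close>

lemma boundedly_invertible_frame_operator: "boundedly_invertible H S"
proof (rule HS.boundedly_invertibleI)
  show "S f \<in> carr H" if "f \<in> carr H" for f
    using that by (simp add: frame_operator_eq fr.frame_op_V J1_V)
  show "S (f - h) = S f - S h" if "f \<in> carr H" "h \<in> carr H" for f h
    using that by (simp add: frame_operator_eq fr.frame_op_diff J1_V J1_diff)
  show "S (scl H c f) = scl H c (S f)" if "f \<in> carr H" for c f
    using that by (simp add: frame_operator_eq fr.frame_op_scale J1_V J1_scale)
  show "\<exists>f\<in>carr H. S f = h" if h: "h \<in> carr H" for h
  proof -
    obtain f where "f \<in> carr H" "fr.frame_op f = h"
      using fr.frame_op_surj[OF h] by blast
    then show ?thesis
      using J1_V by (intro bexI[of _ "J1 f"]) (auto simp: frame_operator_eq J1_J1)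
  qed
  show "A * inn_norm H f \<le> inn_norm H (S f)" if "f \<in> carr H" for f
    using fr.frame_op_lower[OF J1_V[OF that]] that by (simp add: frame_operator_eq J1_norm)
qed (rule bounds_pos)

section \<open>The energetic manifold and the reconstruction formula\<close>

lemma Metric_space_en_dist: "Metric_space D (en_dist K F)"
proof
  fix x y z
  show "0 \<le> en_dist K F x y"
    by (simp add: en_dist_def)
  show "en_dist K F x y = en_dist K F y x"
    by (simp add: en_dist_def KH.M.commute[of x y] DS.M.commute[of x y])
  assume x: "x \<in> D" and y: "y \<in> D"
  show "en_dist K F x y = 0 \<longleftrightarrow> x = y"
    using x y DS.M.zero[of x y] KH.M.zero[of x y]
    by (auto simp: en_dist_def sum_power2_eq_zero_iff)
  assume z: "z \<in> D"
  let ?k = "inn_dist (krein_hilbert K)" and ?d = "inn_dist (D_space K F)"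
  have "en_dist K F x z \<le> sqrt ((?k x y + ?k y z)\<^sup>2 + (?d x y + ?d y z)\<^sup>2)"
    unfolding en_dist_def using x y z KH.M.triangle[of x y z] DS.M.triangle[of x y z]
    by (intro real_sqrt_le_mono add_mono power_mono) auto
  \<comment> \<open>Minkowski's inequality in the plane, applied to the pairs of Krein space and
    \<open>D_space\<close> distances.\<close>
  also have "\<dots> \<le> en_dist K F x y + en_dist K F y z"
    unfolding en_dist_def by (rule real_sqrt_sum_squares_triangle_ineq)
  finally show "en_dist K F x z \<le> en_dist K F x y + en_dist K F y z" .
qed

lemma en_approx_D: "en_approx K F x f \<Longrightarrow> x n \<in> D"
  unfolding en_approx_def Metric_space.MCauchy_def[OF Metric_space_en_dist] by auto

text \<open>The energetic distance dominates that of \<open>D_space\<close>, which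
  \<open>\<iota>\<close> preserves, so energetic Cauchy sequences are Cauchy in the complete space
  \<open>H\<close>.\<close>

lemma en_approx_converges:
  assumes x: "en_approx K F x f"
  obtains h where "h \<in> carr H" "converges_in H (\<lambda>n. \<iota> (x n)) h"
proof (rule HS.Cauchy_converges[of "\<lambda>n. \<iota> (x n)"])
  fix e :: real assume "e > 0"
  then obtain k where k: "\<And>n m. n \<ge> k \<Longrightarrow> m \<ge> k \<Longrightarrow> en_dist K F (x n) (x m) < e"
    using x unfolding en_approx_def Metric_space.MCauchy_def[OF Metric_space_en_dist] by blast
  have "inn_norm H (\<iota> (x n) - \<iota> (x m)) < e" if "n \<ge> k" "m \<ge> k" for n m
  proof -
    have "inn_norm H (\<iota> (x n) - \<iota> (x m)) = inn_dist (D_space K F) (x n) (x m)"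
      using en_approx_D[OF x] by (simp add: inn_dist_def emb_norm D_diff flip: emb_diff)
    also have "\<dots> \<le> en_dist K F (x n) (x m)"
      unfolding en_dist_def by (rule real_sqrt_sum_squares_ge2)
    finally show ?thesis using k[OF that] by simp
  qed
  then show "\<exists>k. \<forall>m\<ge>k. \<forall>n\<ge>m. inn_norm H (\<iota> (x n) - \<iota> (x m)) < e"
    by (meson le_trans)
qed (use en_approx_D[OF x] that in auto)

text \<open>One sequence converges in both spaces. The numbers [x n, z] have the limit [f,z]
  computed in the Krein space and the limit of the extended form computed in \<open>H\<close>; the
  two must agree.\<close>

lemma inn_J1_limit:
  assumes x: "\<And>n. x n \<in> D" "converges_in (krein_hilbert K) x f" "converges_in H (\<lambda>n. \<iota> (x n)) h"
    and z: "z \<in> D"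
  shows "inn H (J1 h) (\<iota> z) = form K f z"
proof (rule LIMSEQ_unique)
  have "converges_in H (\<lambda>n. J1 (\<iota> (x n))) (J1 h)"
    by (rule HS.converges_in_bounded_image[OF J1_V J1_diff, of 1]) (use x in \<open>auto simp: J1_norm\<close>)
  then show "(\<lambda>n. inn H (J1 (\<iota> (x n))) (\<iota> z)) \<longlonglongrightarrow> inn H (J1 h) (\<iota> z)"
    using x z by (intro HS.converges_in_inn) (auto simp: J1_V)
  show "(\<lambda>n. inn H (J1 (\<iota> (x n))) (\<iota> z)) \<longlonglongrightarrow> form K f z"
    using converges_in_form[OF x(2), of z] x(1) z by (simp add: inn_J1_emb)
qed

text \<open>Limits in the Krein space determine limits in \<open>H\<close>: by the preceding lemma, \<open>J1 h\<close> is
  determined by its inner products with a dense set.\<close>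

lemma en_inclusion_eq:
  assumes x: "en_approx K F x f" and h: "converges_in H (\<lambda>n. \<iota> (x n)) h"
  shows "en_inclusion K F H \<iota> f = h"
proof -
  have h_V: "h \<in> carr H" using HS.converges_in_V h .
  have "converges_in H (\<lambda>n. \<iota> (y n)) h" if y: "en_approx K F y f" for y
  proof -
    obtain h' where h': "h' \<in> carr H" "converges_in H (\<lambda>n. \<iota> (y n)) h'"
      by (rule en_approx_converges[OF y])
    have inn_eq: "inn H (J1 h) (\<iota> z) = form K f z" "inn H (J1 h') (\<iota> z) = form K f z" if "z \<in> D" for z
      using inn_J1_limit[OF en_approx_D[OF x] _ h that] inn_J1_limit[OF en_approx_D[OF y] _ h'(2) that]
        x y by (auto simp: en_approx_def)
    have "J1 h - J1 h' = 0"
      by (rule HS.eq_0_if_orthogonal_dense[OF emb_image_V(3) emb_dense])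
        (use h_V h' J1_V inn_eq in \<open>auto simp: HS.inn_diff_left\<close>)
    then have "J1 (J1 h) = J1 (J1 h')" by simp
    then show ?thesis
      using J1_J1 h_V h' by metis
  qed
  then show ?thesis
    unfolding en_inclusion_def
    by (rule_tac the_equality) (use x h HS.converges_in_unique in blast)+
qed

lemma energetic_reconstruction:
  assumes "f \<in> energetic_manifold K F"
  shows "sums_in H (\<lambda>n. scl H (form K f (F n)) (the_inv_into (carr H) S (\<iota> (F n)))) (en_inclusion K F H \<iota> f)"
proof -
  obtain x where x: "en_approx K F x f"
    using assms by (auto simp: energetic_manifold_def)
  then obtain h where h: "h \<in> carr H" "converges_in H (\<lambda>n. \<iota> (x n)) h"
    by (rule en_approx_converges)
  \<comment> \<open>Every \<open>F n\<close> lies in \<open>Mp\<close> or \<open>Mm\<close>, hence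
    in \<open>D\<close>, so it may be taken as the test vector \<open>z\<close>.\<close>
  have "form1 K F H \<iota> h (\<iota> (F n)) = form K f (F n)" for n
    using inn_J1_limit[OF en_approx_D[OF x] _ h(2)] x h(1) by (simp add: form1_eq en_approx_def)
  then have "sums_in H (\<lambda>n. scl H (form K f (F n)) (\<iota> (F n))) (S h)"
    using frame_operator_sums_in[OF h(1)] by simp
  then have "sums_in H (\<lambda>n. the_inv_into (carr H) S (scl H (form K f (F n)) (\<iota> (F n)))) h"
    using h(1) by (intro HS.the_inv_into_sums_in boundedly_invertible_frame_operator) auto
  then show ?thesis
    using HS.the_inv_into_linear(3)[OF boundedly_invertible_frame_operator]
    by (simp add: en_inclusion_eq[OF x h(2)])
qed

end

text \<open>The first two conjuncts give meaning to the third: the \<open>THE\<close> in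
  \<open>frame_operator\<close> really is the sum of its series, and \<open>the_inv_into\<close> is
  a genuine bounded inverse on \<open>H\<close>.\<close>

theorem proposition3p5:
  fixes K :: "'a::ab_group_add krein"
    and F :: "nat \<Rightarrow> 'a"
    and H :: "'b::ab_group_add inner_space"
    and \<iota> :: "'a \<Rightarrow> 'b"
  defines "S \<equiv> frame_operator K F H \<iota>"
  assumes "krein_space K"
    and "J_frame K F"
    and "D_sum K F \<noteq> UNIV"
    and "J_orthogonal K (M_plus K F) (M_minus K F)"
    and "is_completion (D_space K F) H \<iota>"
  shows "(\<forall>f\<in>carr H. sums_in H (\<lambda>n. scl H (form1 K F H \<iota> f (\<iota> (F n))) (\<iota> (F n))) (S f)) \<and>
         boundedly_invertible H S \<and>
         (\<forall>f\<in>energetic_manifold K F.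
            sums_in H (\<lambda>n. scl H (form K f (F n)) (the_inv_into (carr H) S (\<iota> (F n))))
              (en_inclusion K F H \<iota> f))"
proof -
  obtain A B where "0 < A" "A \<le> B" "frame_bounds K F (N_plus K F) A B" "frame_bounds K F (N_minus K F) A B"
    using \<open>J_frame K F\<close> unfolding J_frame_def by blast
  then interpret jframe_completion K F H \<iota> A B
    using assms by unfold_locales (auto simp: J_frame_def maximal_positive_def maximal_negative_def)
  show ?thesis
    unfolding S_def
    using frame_operator_sums_in boundedly_invertible_frame_operator energetic_reconstruction by blast
qed

end
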